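(* Let $R$ be a simple unital associative algebra over $\mathbb{K}$ and let $H$ be a nontrivial subloop of $\mathcal{J}(R)$ such that $[\mathcal{J}(R),H]\subseteq H$. Then there exists $n\ge1$ such that $\mathcal{J}_{n+2}(R)\subseteq H\subseteq\mathcal{J}_n(R)$. In particular, $H$ is a closed normal subloop of $\mathcal{J}(R)$.
   Context: $\mathbb{K}$ is a field of characteristic zero; $R$ need not be commutative. $\mathcal{J}(R):=\{t+\sum_{i\ge1}\alpha_it^{i+1}\mid\alpha_i\in R\}\subseteq R[[t]]$ (with $t$ central) is a loop with unit $t$ under substitution $$\Big(\sum_{i\ge0}\alpha_it^{i+1}\Big)\circ\Big(\sum_{j\ge0}\beta_jt^{j+1}\Big):=\sum_{i\ge0}\alpha_i\Big(\sum_{j\ge0}\beta_jt^{j+1}\Big)^{i+1}\qquad(\alpha_0=\beta_0=1).$$ $\mathcal{J}_n(R):=\{t+\sum_{i\ge n}\alpha_it^{i+1}\mid\alpha_i\in R\}$. $\mathcal{J}(R)$ carries the topology in which $\{\mathcal{J}_n(R)\mid n\ge1\}$ is a base of neighborhoods of the unit element $t$. The commutator is $[a,b]:=(b\circ a)\backslash(a\circ b)$, where $x\backslash y$ is the unique $z$ with $x\circ z=y$, and $[\mathcal{J}(R),H]\subseteq H$ means $[a,h]\in H$ for all $a\in\mathcal{J}(R)$, $h\in H$. Nontrivial means $H\ne\{t\}$. A subloop is normal if it is the kernel of a loop homomorphism. *)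

theory Defs
  imports
    "HOL-Computational_Algebra.Formal_Power_Series"
    "HOL-Algebra.Coset"
    "HOL-Analysis.Abstract_Topology"
begin

unbundle fps_syntax

section \<open>Simple algebras\<close>

text \<open>
  Unital associative algebras over a field: the underlying ring is that of the type class
  \<^class>\<open>ring_1\<close> (not necessarily commutative, and with \<open>0 \<noteq> 1\<close>).
\<close>

locale unital_algebra = vector_space scale
  for scale :: "'k::field \<Rightarrow> 'a::ring_1 \<Rightarrow> 'a" +
  assumes scale_mult_left: "scale c x * y = scale c (x * y)"
    and scale_mult_right: "x * scale c y = scale c (x * y)"

definition two_sided_ideal :: "('k::field \<Rightarrow> 'a::ring_1 \<Rightarrow> 'a) \<Rightarrow> 'a set \<Rightarrow> bool" where
  "two_sided_ideal scale I \<longleftrightarrow>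
     module.subspace scale I \<and> (\<forall>r. \<forall>x\<in>I. r * x \<in> I \<and> x * r \<in> I)"

locale simple_unital_algebra = unital_algebra +
  assumes simple: "two_sided_ideal scale I \<Longrightarrow> I = {0} \<or> I = UNIV"


section \<open>Loops\<close>

text \<open>
  A loop is a \<^typ>\<open>('a, 'm) monoid_scheme\<close> whose multiplication need not be associative.
\<close>

locale loop =
  fixes L (structure)
  assumes m_closed: "\<lbrakk>x \<in> carrier L; y \<in> carrier L\<rbrakk> \<Longrightarrow> x \<otimes> y \<in> carrier L"
    and one_closed: "\<one> \<in> carrier L"
    and l_one: "x \<in> carrier L \<Longrightarrow> \<one> \<otimes> x = x"
    and r_one: "x \<in> carrier L \<Longrightarrow> x \<otimes> \<one> = x"
    and ex1_ldiv: "\<lbrakk>x \<in> carrier L; y \<in> carrier L\<rbrakk> \<Longrightarrow> \<exists>!z. z \<in> carrier L \<and> x \<otimes> z = y"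
    and ex1_rdiv: "\<lbrakk>x \<in> carrier L; y \<in> carrier L\<rbrakk> \<Longrightarrow> \<exists>!z. z \<in> carrier L \<and> z \<otimes> x = y"

text \<open>\<open>ldiv L x y\<close> is \<open>x \ y\<close> and \<open>rdiv L y x\<close> is \<open>y / x\<close>.\<close>

definition ldiv :: "('a, 'm) monoid_scheme \<Rightarrow> 'a \<Rightarrow> 'a \<Rightarrow> 'a" where
  "ldiv L x y = (THE z. z \<in> carrier L \<and> x \<otimes>\<^bsub>L\<^esub> z = y)"

definition rdiv :: "('a, 'm) monoid_scheme \<Rightarrow> 'a \<Rightarrow> 'a \<Rightarrow> 'a" where
  "rdiv L y x = (THE z. z \<in> carrier L \<and> z \<otimes>\<^bsub>L\<^esub> x = y)"

definition commutator :: "('a, 'm) monoid_scheme \<Rightarrow> 'a \<Rightarrow> 'a \<Rightarrow> 'a" where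
  "commutator L a b = ldiv L (b \<otimes>\<^bsub>L\<^esub> a) (a \<otimes>\<^bsub>L\<^esub> b)"

definition subloop :: "'a set \<Rightarrow> ('a, 'm) monoid_scheme \<Rightarrow> bool" where
  "subloop H L \<longleftrightarrow>
     H \<subseteq> carrier L \<and> \<one>\<^bsub>L\<^esub> \<in> H \<and>
     (\<forall>x\<in>H. \<forall>y\<in>H. x \<otimes>\<^bsub>L\<^esub> y \<in> H \<and> ldiv L x y \<in> H \<and> rdiv L x y \<in> H)"

text \<open>
  Multiplicative maps between loops preserve the unit and both divisions, so \<^const>\<open>hom\<close> is
  the set of loop homomorphisms.  A definition cannot quantify over the type of the codomain;
  codomains on \<^typ>\<open>'a set\<close> are enough, by \<open>normal_subloop_kernel\<close> below.
\<close>

definition normal_subloop :: "'a set \<Rightarrow> ('a, 'm) monoid_scheme \<Rightarrow> bool" where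
  "normal_subloop H L \<longleftrightarrow>
     subloop H L \<and> (\<exists>(M :: 'a set monoid) f. loop M \<and> f \<in> hom L M \<and> kernel L M f = H)"

lemma (in loop) ldiv_eqI:
  assumes "x \<in> carrier L" "y \<in> carrier L" "z \<in> carrier L" "x \<otimes> z = y"
  shows "ldiv L x y = z"
  unfolding ldiv_def using ex1_ldiv[OF assms(1,2)] assms(3,4) by blast

lemma (in loop) rdiv_eqI:
  assumes "x \<in> carrier L" "y \<in> carrier L" "z \<in> carrier L" "z \<otimes> x = y"
  shows "rdiv L y x = z"
  unfolding rdiv_def using ex1_rdiv[OF assms(1,2)] assms(3,4) by blast

lemma loop_hom_one:
  assumes "loop L" "loop M" "f \<in> hom L M"
  shows "f \<one>\<^bsub>L\<^esub> = \<one>\<^bsub>M\<^esub>"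
proof -
  interpret L: loop L by fact
  interpret M: loop M by fact
  have c: "f \<one>\<^bsub>L\<^esub> \<in> carrier M"
    using assms(3) L.one_closed by (auto simp: hom_def)
  have "f \<one>\<^bsub>L\<^esub> \<otimes>\<^bsub>M\<^esub> f \<one>\<^bsub>L\<^esub> = f (\<one>\<^bsub>L\<^esub> \<otimes>\<^bsub>L\<^esub> \<one>\<^bsub>L\<^esub>)"
    using assms(3) L.one_closed by (auto simp: hom_def)
  also have "\<dots> = f \<one>\<^bsub>L\<^esub>" using L.l_one L.one_closed by simp
  finally show ?thesis
    using M.ex1_ldiv[OF c c] M.r_one[OF c] M.one_closed c by blast
qed

lemma subloop_kernel:
  assumes "loop L" "loop M" "f \<in> hom L M"
  shows "subloop (kernel L M f) L"
proof -
  interpret L: loop L by fact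
  interpret M: loop M by fact
  have mult: "f (x \<otimes>\<^bsub>L\<^esub> y) = f x \<otimes>\<^bsub>M\<^esub> f y" if "x \<in> carrier L" "y \<in> carrier L" for x y
    using assms(3) that by (auto simp: hom_def)
  have cl: "f x \<in> carrier M" if "x \<in> carrier L" for x
    using assms(3) that by (auto simp: hom_def)
  have "ldiv L x y \<in> kernel L M f" if x: "x \<in> kernel L M f" and y: "y \<in> kernel L M f" for x y
  proof -
    obtain z where z: "z \<in> carrier L" "x \<otimes>\<^bsub>L\<^esub> z = y"
      using L.ex1_ldiv x y unfolding kernel_def by blast
    have "f z = \<one>\<^bsub>M\<^esub>"
      using mult[of x z] M.l_one[OF cl[OF z(1)]] x y z by (simp add: kernel_def)
    then show ?thesis using L.ldiv_eqI[of x y z] x y z by (simp add: kernel_def)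
  qed
  moreover have "rdiv L x y \<in> kernel L M f"
    if x: "x \<in> kernel L M f" and y: "y \<in> kernel L M f" for x y
  proof -
    obtain z where z: "z \<in> carrier L" "z \<otimes>\<^bsub>L\<^esub> y = x"
      using L.ex1_rdiv x y unfolding kernel_def by blast
    have "f z = \<one>\<^bsub>M\<^esub>"
      using mult[of z y] M.r_one[OF cl[OF z(1)]] x y z by (simp add: kernel_def)
    then show ?thesis using L.rdiv_eqI[of y x z] x y z by (simp add: kernel_def)
  qed
  ultimately show ?thesis
    using loop_hom_one[OF assms] L.one_closed L.m_closed mult M.l_one M.one_closed
    by (auto simp: subloop_def kernel_def)
qed

lemma normal_subloop_kernel:
  fixes L :: "('a, 'm) monoid_scheme" and M :: "('b, 'n) monoid_scheme"
  assumes "loop L" "loop M" "f \<in> hom L M"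
  shows "normal_subloop (kernel L M f) L"
proof -
  interpret L: loop L by fact
  interpret M: loop M by fact
  have mult: "f (x \<otimes>\<^bsub>L\<^esub> y) = f x \<otimes>\<^bsub>M\<^esub> f y" if "x \<in> carrier L" "y \<in> carrier L" for x y
    using assms(3) that by (auto simp: hom_def)
  have cl: "f x \<in> carrier M" if "x \<in> carrier L" for x
    using assms(3) that by (auto simp: hom_def)
  define F where "F x = {y \<in> carrier L. f y = f x}" for x
  have F_eq: "F x = F y \<longleftrightarrow> f x = f y" if "x \<in> carrier L" "y \<in> carrier L" for x y
    using that by (auto simp: F_def)
  define r where "r A = (SOME x. x \<in> A)" for A :: "'a set"
  have r: "r (F x) \<in> carrier L" "f (r (F x)) = f x" if "x \<in> carrier L" for x
  proof -
    have "r (F x) \<in> F x"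
      unfolding r_def by (rule someI[of _ x]) (use that in \<open>simp add: F_def\<close>)
    then show "r (F x) \<in> carrier L" "f (r (F x)) = f x" by (auto simp: F_def)
  qed
  define Q :: "'a set monoid" where
    "Q = \<lparr>carrier = F ` carrier L, mult = (\<lambda>A B. F (r A \<otimes>\<^bsub>L\<^esub> r B)), one = F \<one>\<^bsub>L\<^esub>\<rparr>"
  have Q_mult: "F x \<otimes>\<^bsub>Q\<^esub> F y = F (x \<otimes>\<^bsub>L\<^esub> y)" if "x \<in> carrier L" "y \<in> carrier L" for x y
    using that r by (auto simp: Q_def F_def mult)
  have Q_carrier: "carrier Q = F ` carrier L" and Q_one: "\<one>\<^bsub>Q\<^esub> = F \<one>\<^bsub>L\<^esub>"
    by (auto simp: Q_def)
  have "loop Q"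
  proof
    fix A B assume "A \<in> carrier Q" "B \<in> carrier Q"
    then obtain a b where a: "a \<in> carrier L" "A = F a" and b: "b \<in> carrier L" "B = F b"
      by (auto simp: Q_carrier)
    show "A \<otimes>\<^bsub>Q\<^esub> B \<in> carrier Q"
      using a b Q_mult L.m_closed by (auto simp: Q_carrier)
    show "\<exists>!C. C \<in> carrier Q \<and> A \<otimes>\<^bsub>Q\<^esub> C = B"
    proof -
      obtain z where z: "z \<in> carrier L" "a \<otimes>\<^bsub>L\<^esub> z = b" using L.ex1_ldiv a b by blast
      have uniq: "C = F z" if "C \<in> carrier Q" "A \<otimes>\<^bsub>Q\<^esub> C = B" for C
      proof -
        obtain c where c: "c \<in> carrier L" "C = F c" using \<open>C \<in> carrier Q\<close> by (auto simp: Q_carrier)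
        have "f a \<otimes>\<^bsub>M\<^esub> f c = f b"
          using that a b c Q_mult F_eq L.m_closed mult by simp
        moreover have "f a \<otimes>\<^bsub>M\<^esub> f z = f b" using mult a z by metis
        ultimately have "f c = f z" using M.ex1_ldiv[of "f a" "f b"] cl a b c z by blast
        then show ?thesis using F_eq c z by simp
      qed
      have "F z \<in> carrier Q \<and> A \<otimes>\<^bsub>Q\<^esub> F z = B"
        using z a b Q_mult by (auto simp: Q_carrier)
      then show ?thesis by (rule ex1I[of _ "F z"]) (rule uniq; elim conjE; assumption)
    qed
    show "\<exists>!C. C \<in> carrier Q \<and> C \<otimes>\<^bsub>Q\<^esub> A = B"
    proof -
      obtain z where z: "z \<in> carrier L" "z \<otimes>\<^bsub>L\<^esub> a = b" using L.ex1_rdiv a b by blast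
      have uniq: "C = F z" if "C \<in> carrier Q" "C \<otimes>\<^bsub>Q\<^esub> A = B" for C
      proof -
        obtain c where c: "c \<in> carrier L" "C = F c" using \<open>C \<in> carrier Q\<close> by (auto simp: Q_carrier)
        have "f c \<otimes>\<^bsub>M\<^esub> f a = f b"
          using that a b c Q_mult F_eq L.m_closed mult by simp
        moreover have "f z \<otimes>\<^bsub>M\<^esub> f a = f b" using mult a z by metis
        ultimately have "f c = f z" using M.ex1_rdiv[of "f a" "f b"] cl a b c z by blast
        then show ?thesis using F_eq c z by simp
      qed
      have "F z \<in> carrier Q \<and> F z \<otimes>\<^bsub>Q\<^esub> A = B"
        using z a b Q_mult by (auto simp: Q_carrier)
      then show ?thesis by (rule ex1I[of _ "F z"]) (rule uniq; elim conjE; assumption)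
    qed
  next
    fix A assume "A \<in> carrier Q"
    then obtain a where a: "a \<in> carrier L" "A = F a" by (auto simp: Q_carrier)
    show "\<one>\<^bsub>Q\<^esub> \<otimes>\<^bsub>Q\<^esub> A = A" "A \<otimes>\<^bsub>Q\<^esub> \<one>\<^bsub>Q\<^esub> = A"
      using a Q_mult L.one_closed L.l_one L.r_one by (auto simp: Q_one)
  next
    show "\<one>\<^bsub>Q\<^esub> \<in> carrier Q" using L.one_closed by (auto simp: Q_one Q_carrier)
  qed
  moreover have "F \<in> hom L Q"
    using Q_mult by (auto simp: hom_def Q_carrier)
  moreover have "kernel L Q F = kernel L M f"
    unfolding kernel_def Q_one
    using F_eq[OF _ L.one_closed] loop_hom_one[OF assms] by (simp cong: conj_cong)
  ultimately show ?thesis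
    using subloop_kernel[OF assms] unfolding normal_subloop_def by blast
qed


section \<open>The loop of formal power series under substitution\<close>

text \<open>
  The series \<open>t + (\<Sum>i\<ge>n. \<alpha>\<^sub>i t\<^sup>i\<^sup>+\<^sup>1)\<close>, for \<open>n \<ge> 1\<close>; the variable \<open>t\<close> is \<^const>\<open>fps_X\<close>.
\<close>

definition J_sub :: "nat \<Rightarrow> 'a::ring_1 fps set" where
  "J_sub n = {f. f $ 0 = 0 \<and> f $ 1 = 1 \<and> (\<forall>i. 1 \<le> i \<and> i < n \<longrightarrow> f $ (i + 1) = 0)}"

text \<open>
  The library's \<open>a oo b\<close> is \<open>\<Sum>i. a $ i * b ^ i\<close>, with the coefficients of \<open>a\<close> on the left.
\<close>

definition J_loop :: "'a::ring_1 fps monoid" where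
  "J_loop = \<lparr>carrier = J_sub 1, mult = (oo), one = fps_X\<rparr>"

text \<open>
  The topology in which the sets \<open>J_sub n\<close> are a base of neighborhoods of the unit; the
  neighborhoods of an arbitrary \<open>a\<close> are obtained from these by left translation.
\<close>

definition J_open :: "'a::ring_1 fps set \<Rightarrow> bool" where
  "J_open U \<longleftrightarrow> U \<subseteq> J_sub 1 \<and> (\<forall>a\<in>U. \<exists>n\<ge>1. (\<lambda>b. a oo b) ` J_sub n \<subseteq> U)"

definition J_topology :: "'a::ring_1 fps topology" where
  "J_topology = topology J_open"

lemma J_sub_antimono: "m \<le> n \<Longrightarrow> J_sub n \<subseteq> J_sub m"
  by (auto simp: J_sub_def)

lemma istopology_J_open: "istopology (J_open :: 'a::ring_1 fps set \<Rightarrow> bool)"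
  unfolding istopology_def
proof (intro conjI allI impI)
  fix S T :: "'a fps set"
  assume S: "J_open S" and T: "J_open T"
  show "J_open (S \<inter> T)"
    unfolding J_open_def
  proof (intro conjI ballI)
    show "S \<inter> T \<subseteq> J_sub 1" using S by (auto simp: J_open_def)
    fix a assume "a \<in> S \<inter> T"
    then obtain m n where "m \<ge> 1" "n \<ge> 1"
      "(\<lambda>b. a oo b) ` J_sub m \<subseteq> S" "(\<lambda>b. a oo b) ` J_sub n \<subseteq> T"
      using S T unfolding J_open_def by blast
    moreover have "J_sub (max m n) \<subseteq> (J_sub m :: 'a fps set)" "J_sub (max m n) \<subseteq> (J_sub n :: 'a fps set)"
      by (rule J_sub_antimono, simp)+
    ultimately have "max m n \<ge> 1 \<and> (\<lambda>b. a oo b) ` J_sub (max m n) \<subseteq> S \<inter> T"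
      by (intro conjI subsetI) (simp, blast)
    then show "\<exists>k\<ge>1. (\<lambda>b. a oo b) ` J_sub k \<subseteq> S \<inter> T" by blast
  qed
next
  fix \<K> :: "'a fps set set"
  assume \<K>: "\<forall>K\<in>\<K>. J_open K"
  show "J_open (\<Union>\<K>)"
    unfolding J_open_def
  proof (intro conjI ballI)
    show "\<Union>\<K> \<subseteq> J_sub 1" using \<K> unfolding J_open_def by (intro Union_least) blast
    fix a assume "a \<in> \<Union>\<K>"
    then obtain K where K: "K \<in> \<K>" "a \<in> K" by blast
    then obtain n where "n \<ge> 1" "(\<lambda>b. a oo b) ` J_sub n \<subseteq> K"
      using \<K> unfolding J_open_def by meson
    moreover have "K \<subseteq> \<Union>\<K>" using K by blast
    ultimately show "\<exists>n\<ge>1. (\<lambda>b. a oo b) ` J_sub n \<subseteq> \<Union>\<K>"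
      by (meson order_trans)
  qed
qed

lemma openin_J_topology: "openin J_topology U \<longleftrightarrow> J_open U"
  by (simp add: J_topology_def topology_inverse'[OF istopology_J_open])

end

theory Submission
  imports Defs
begin

text \<open>
  Write \<open>J\<^sub>k\<close> for \<^term>\<open>J_sub k\<close>. Everything rests on how a substitution changes when one of
  its arguments is perturbed in degree \<open>p\<close>: to first order the perturbation passes through
  unchanged, and the first correction, \<open>k\<close> degrees higher, has a bilinear leading coefficient
  (\<open>compose_inner_lead\<close>, \<open>compose_outer_lead\<close>). As \<open>t\<close> is central, these two facts hold over any
  ring. They make \<open>J\<close> a loop, because division can be solved degree by degree, and they
  compute commutators to leading order: if \<open>a = t + \<alpha> t\<^sup>m\<^sup>+\<^sup>1 + \<dots>\<close> and
  \<open>h = t + \<beta> t\<^sup>k\<^sup>+\<^sup>1 + \<dots>\<close>, then \<open>[a, h] = t + ((m+1) \<alpha>\<beta> - (k+1) \<beta>\<alpha>) t\<^sup>m\<^sup>+\<^sup>k\<^sup>+\<^sup>1 + \<dots>\<close>.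

  Let \<open>n\<close> be maximal with \<open>H \<subseteq> J\<^sub>n\<close>, and let \<open>\<Lambda>\<^sub>k\<close> be the additive group of coefficients of
  \<open>t\<^sup>k\<^sup>+\<^sup>1\<close> in elements of \<open>H \<inter> J\<^sub>k\<close>. For a nonzero \<open>\<beta> \<in> \<Lambda>\<^sub>n\<close>, the group \<open>\<Lambda>\<^sub>n\<^sub>+\<^sub>2\<close> is reached
  from \<open>\<beta>\<close> in two ways: by one commutator with \<open>t + \<alpha> t\<^sup>3\<close> and by two successive commutators
  with series \<open>t + \<alpha> t\<^sup>2\<close>. Comparing the results shows that \<open>R\<beta>R \<subseteq> \<Lambda>\<^sub>n\<^sub>+\<^sub>2\<close>
  (\<open>leading_coeffs_two_sided\<close>), so \<open>\<Lambda>\<^sub>n\<^sub>+\<^sub>2 = R\<close> by simplicity. A further commutator with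
  \<open>t + \<alpha> t\<^sup>2\<close> multiplies by a nonzero integer, so \<open>\<Lambda>\<^sub>k = R\<close> for all \<open>k \<ge> n + 2\<close>.

  This alone only shows that \<open>H\<close> is dense in \<open>J\<^sub>n\<^sub>+\<^sub>2\<close>. To get equality, fix \<open>h \<in> H \<inter> J\<^sub>k\<close> with
  leading coefficient \<open>1\<close>, where \<open>k = n + 2\<close>. For \<open>a \<in> J\<^sub>k\<^sub>+\<^sub>1\<close> the map \<open>a \<mapsto> [a, h]\<close> raises
  degrees by \<open>k\<close> and multiplies the coefficient of \<open>t\<^sup>m\<^sup>+\<^sup>1\<close> by \<open>m - k > 0\<close> to leading order, so it maps \<open>J\<^sub>k\<^sub>+\<^sub>1\<close> onto \<open>J\<^sub>2\<^sub>k\<^sub>+\<^sub>1\<close>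
  (\<open>commutator_surj\<close>). Hence \<open>J\<^sub>2\<^sub>k\<^sub>+\<^sub>1 \<subseteq> H\<close>, and finitely many divisions by elements of \<open>H\<close> bring
  this down to \<open>J\<^sub>k \<subseteq> H\<close>.

  Given \<open>J\<^sub>n\<^sub>+\<^sub>2 \<subseteq> H \<subseteq> J\<^sub>n\<close>, the complement of \<open>H\<close> is stable under right multiplication by
  \<open>J\<^sub>n\<^sub>+\<^sub>2\<close>, so \<open>H\<close> is closed. For normality only the coefficients in degrees \<open>n + 1\<close> and \<open>n + 2\<close>
  matter. There \<open>x \<circ> (y \<circ> h)\<close> and \<open>(x \<circ> y) \<circ> h\<close> coincide, while \<open>(x \<circ> h) \<circ> y\<close> and
  \<open>(x \<circ> y) \<circ> h\<close> differ only by the commutator \<open>[y, h] \<in> H\<close>; so left and right translations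
  permute the cosets of \<open>H\<close> (\<open>normal_subloopI_cosets\<close>).
\<close>

section \<open>Power series that agree below a given degree\<close>

definition agree :: "nat \<Rightarrow> 'a::ring_1 fps \<Rightarrow> 'a fps \<Rightarrow> bool" where
  "agree p u v \<longleftrightarrow> (\<forall>i<p. u $ i = v $ i)"

lemma agree_refl [simp]: "agree p u u"
  by (simp add: agree_def)

lemma agree_sym: "agree p u v \<Longrightarrow> agree p v u"
  by (simp add: agree_def)

lemma agree_trans: "agree p u v \<Longrightarrow> agree p v w \<Longrightarrow> agree p u w"
  by (simp add: agree_def)

lemma agree_mono: "agree p u v \<Longrightarrow> q \<le> p \<Longrightarrow> agree q u v"
  by (simp add: agree_def)

lemma agree_Suc: "agree (Suc p) u v \<longleftrightarrow> agree p u v \<and> u $ p = v $ p"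
  by (auto simp: agree_def less_Suc_eq)

lemma agree_diff: "agree p (u - v) 0 \<longleftrightarrow> agree p u v"
  by (auto simp: agree_def)

lemma J_sub_iff_agree: "1 \<le> k \<Longrightarrow> f \<in> J_sub k \<longleftrightarrow> agree (Suc k) f fps_X"
proof -
  assume k: "1 \<le> k"
  have "f $ i = fps_X $ i" if "f \<in> J_sub k" "i < Suc k" for i
  proof (cases "i \<le> 1")
    case True then show ?thesis using that by (cases i) (auto simp: J_sub_def)
  next
    case False
    then have "f $ ((i - 1) + 1) = 0" using that unfolding J_sub_def by (cases i) auto
    then show ?thesis using False by simp
  qed
  moreover have "f \<in> J_sub k" if "agree (Suc k) f fps_X"
    using that k by (auto simp: J_sub_def agree_def)
  ultimately show ?thesis unfolding agree_def by blast
qed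

lemma J_sub_1_iff: "f \<in> J_sub (Suc 0) \<longleftrightarrow> f $ 0 = 0 \<and> f $ Suc 0 = 1"
  by (auto simp: J_sub_def)

lemma fps_eq_iff_agree: "u = v \<longleftrightarrow> (\<forall>q. agree q u v)"
  by (auto simp: agree_def fps_eq_iff)

lemma fps_X_in_J [simp]: "fps_X \<in> J_sub n"
  by (auto simp: J_sub_def)

lemma J_1_iff_agree: "f \<in> J_sub 1 \<longleftrightarrow> agree 2 f fps_X"
  using J_sub_iff_agree[of 1 f] by (simp add: numeral_2_eq_2)

lemma J_sub_subset_1: "J_sub k \<subseteq> J_sub 1"
  by (auto simp: J_sub_def)

section \<open>Composition to first order\<close>

text \<open>
  The leading terms of two series multiply; the orders \<open>a\<close> and \<open>b\<close> are only lower bounds, so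
  the coefficients \<open>f $ a\<close> and \<open>g $ b\<close> may vanish.
\<close>

lemma fps_mult_lead:
  fixes f g :: "'a::ring_1 fps"
  assumes "agree a f 0" "agree b g 0"
  shows "agree (a + b) (f * g) 0" and "(f * g) $ (a + b) = f $ a * g $ b"
proof -
  have z: "f $ i * g $ (n - i) = 0" if "n \<le> a + b" "i \<noteq> a \<or> n < a + b" "i \<le> n" for i n
  proof (cases "i < a")
    case False
    then have "n - i < b" using that by auto
    then show ?thesis using assms by (simp add: agree_def)
  qed (use assms in \<open>simp add: agree_def\<close>)
  show "agree (a + b) (f * g) 0"
    by (auto simp: agree_def fps_mult_nth z intro!: sum.neutral)
  have "(f * g) $ (a + b) = (\<Sum>i\<in>{a}. f $ i * g $ (a + b - i))"
    unfolding fps_mult_nth by (rule sum.mono_neutral_right) (auto simp: z)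
  then show "(f * g) $ (a + b) = f $ a * g $ b" by simp
qed

lemma fps_power_lead:
  fixes f :: "'a::ring_1 fps"
  assumes "f \<in> J_sub 1"
  shows "agree j (f ^ j) 0 \<and> (f ^ j) $ j = 1"
proof (induction j)
  case (Suc j)
  have "agree 1 f 0" using assms by (auto simp: agree_def J_sub_1_iff)
  from fps_mult_lead[OF this conjunct1[OF Suc]] Suc assms show ?case
    by (simp add: J_sub_1_iff)
qed (simp add: agree_def)

text \<open>
  This is the derivative of the power map at leading order, from
  \<open>f\<^sup>j\<^sup>+\<^sup>1 - g\<^sup>j\<^sup>+\<^sup>1 = (f - g) f\<^sup>j + g (f\<^sup>j - g\<^sup>j)\<close>: since \<open>f\<close> and \<open>g\<close> both start with the
  central term \<open>t\<close>, every factor other than \<open>f - g\<close> acts on leading terms as multiplication by \<open>t\<close>.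
\<close>

lemma fps_power_diff:
  fixes f g :: "'a::ring_1 fps"
  assumes f: "f \<in> J_sub 1" and g: "g \<in> J_sub 1" and p: "agree p f g" "1 \<le> p"
  shows "agree (p + j - 1) (f ^ j) (g ^ j) \<and>
    (f ^ j) $ (p + j - 1) - (g ^ j) $ (p + j - 1) = of_nat j * (f $ p - g $ p)"
proof (induction j)
  case (Suc j)
  have fg: "agree p (f - g) 0" using p by (simp add: agree_diff)
  have g1: "agree 1 g 0" "g $ 1 = 1" using g by (auto simp: agree_def J_sub_1_iff)
  have d: "agree (p + j - 1) (f ^ j - g ^ j) 0" using Suc by (simp add: agree_diff)
  have idx: "1 + (p + j - 1) = p + j" using p by simp
  have eq: "f ^ Suc j - g ^ Suc j = (f - g) * f ^ j + g * (f ^ j - g ^ j)"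
    by (simp add: algebra_simps)
  note L = fps_mult_lead[OF fg conjunct1[OF fps_power_lead[OF f, of j]]]
  note R = fps_mult_lead[OF g1(1) d, unfolded idx]
  have "agree (p + j) (f ^ Suc j - g ^ Suc j) 0"
    unfolding eq using L(1) R(1) by (simp add: agree_def)
  moreover have "(f ^ Suc j - g ^ Suc j) $ (p + j) = of_nat (Suc j) * (f $ p - g $ p)"
  proof -
    have "(f ^ Suc j - g ^ Suc j) $ (p + j)
        = (f - g) $ p * (f ^ j) $ j + g $ 1 * (f ^ j - g ^ j) $ (p + j - 1)"
      unfolding eq fps_add_nth L(2) R(2) ..
    then show ?thesis
      using Suc fps_power_lead[OF f, of j] g1 by (simp add: distrib_right)
  qed
  ultimately show ?case by (simp add: agree_diff)
qed (simp)

lemma fps_compose_X: "a oo fps_X = (a :: 'a::ring_1 fps)"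
  by (simp add: fps_eq_iff fps_compose_nth mult_delta_right)

lemma fps_X_compose: "a $ 0 = 0 \<Longrightarrow> fps_X oo a = (a :: 'a::ring_1 fps)"
proof (rule fps_ext)
  fix n assume "a $ 0 = 0"
  then show "(fps_X oo a) $ n = a $ n"
    by (cases "n = 0") (auto simp: fps_compose_nth mult_delta_left)
qed

lemma compose_diff_left: "(u - v) oo w = (u oo w) - (v oo w :: 'a::ring_1 fps)"
  by (simp add: fps_eq_iff fps_compose_nth left_diff_distrib sum_subtractf)

text \<open>
  Only the term \<open>d\<^sub>p (h\<^sup>p - t\<^sup>p)\<close> of \<open>d \<circ> h - d = \<Sum>\<^sub>i d\<^sub>i (h\<^sup>i - t\<^sup>i)\<close> reaches degree
  \<open>p + k\<close>, as \<open>h\<^sup>i\<close> and \<open>t\<^sup>i\<close> agree below degree \<open>k + i\<close>. Because composition is additive in its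
  outer argument, this also describes the effect of perturbing the outer argument by \<open>d\<close>.
\<close>

lemma compose_inner_lead:
  fixes d h :: "'a::ring_1 fps"
  assumes d: "agree p d 0" and h: "h \<in> J_sub k" and k: "1 \<le> k"
  shows "agree (p + k) (d oo h) d"
    and "(d oo h) $ (p + k) = d $ (p + k) + of_nat p * (d $ p * h $ Suc k)"
proof -
  have h1: "h \<in> J_sub 1" using h J_sub_subset_1 by auto
  have X1: "fps_X \<in> J_sub 1" by (simp add: J_sub_1_iff)
  have ag: "agree (Suc k) h fps_X" using h k by (simp add: J_sub_iff_agree)
  note P = fps_power_diff[OF h1 X1 ag, simplified]
  have eq: "(d oo h) $ n - d $ n = (\<Sum>i=0..n. d $ i * ((h ^ i) $ n - (fps_X ^ i) $ n))" for n
  proof -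
    have "(d oo h) $ n - d $ n = (d oo h) $ n - (d oo fps_X) $ n" by (simp add: fps_compose_X)
    also have "\<dots> = (\<Sum>i=0..n. d $ i * ((h ^ i) $ n - (fps_X ^ i) $ n))"
      by (simp only: fps_compose_nth right_diff_distrib sum_subtractf)
    finally show ?thesis .
  qed
  have z: "d $ i * ((h ^ i) $ n - (fps_X ^ i) $ n) = 0" if "n \<le> p + k" "i \<noteq> p \<or> n < p + k" for i n
  proof (cases "i < p")
    case True then show ?thesis using d by (simp add: agree_def)
  next
    case False
    then have "n < k + i" using that by auto
    then have "(h ^ i) $ n = (fps_X ^ i) $ n" using P[of i] unfolding agree_def by auto
    then show ?thesis by simp
  qed
  have "(d oo h) $ n - d $ n = 0" if "n < p + k" for n
    unfolding eq by (rule sum.neutral) (use z that in auto)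
  then show "agree (p + k) (d oo h) d" by (simp add: agree_def)
  have "(d oo h) $ (p + k) - d $ (p + k)
      = (\<Sum>i\<in>{p}. d $ i * ((h ^ i) $ (p + k) - (fps_X ^ i) $ (p + k)))"
    unfolding eq by (rule sum.mono_neutral_right) (use z in auto)
  also have "\<dots> = d $ p * (of_nat p * h $ Suc k)"
    using P[of p] k by (simp add: add.commute)
  also have "\<dots> = of_nat p * (d $ p * h $ Suc k)"
    by (metis mult.assoc mult_of_nat_commute)
  finally show "(d oo h) $ (p + k) = d $ (p + k) + of_nat p * (d $ p * h $ Suc k)"
    by (simp add: algebra_simps)
qed

text \<open>
  Perturbing the inner argument: subtracting \<open>t\<close> from \<open>h\<close> leaves a series that starts in degree
  \<open>k + 1\<close>, whose first term is the only one to contribute in degree \<open>p + k\<close>.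
\<close>

lemma compose_outer_lead:
  fixes h a b :: "'a::ring_1 fps"
  assumes h: "h \<in> J_sub k" and k: "1 \<le> k"
    and a: "a \<in> J_sub 1" and b: "b \<in> J_sub 1" and p: "agree p a b" "1 \<le> p"
  shows "agree (p + k) ((h oo a) - (h oo b)) (a - b)"
    and "((h oo a) - (h oo b)) $ (p + k)
      = (a - b) $ (p + k) + of_nat (Suc k) * (h $ Suc k * (a $ p - b $ p))"
proof -
  \<comment> \<open>In \<open>h = t + e\<close> the summand \<open>t\<close> returns \<open>a - b\<close> itself, so the correction comes from \<open>e\<close>.\<close>
  define e where "e = h - fps_X"
  have e: "agree (Suc k) e 0" using h k by (simp add: e_def J_sub_iff_agree agree_diff)
  have ek: "e $ Suc k = h $ Suc k" using k by (simp add: e_def)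
  note P = fps_power_diff[OF a b p]
  have "(h oo a) - (h oo b) - (a - b) = (e oo a) - (e oo b)"
    unfolding e_def compose_diff_left using a b
    by (simp add: fps_X_compose J_sub_1_iff)
  then have "((h oo a) - (h oo b)) $ n - (a - b) $ n = (e oo a) $ n - (e oo b) $ n" for n
    by (metis fps_sub_nth)
  then have eq: "((h oo a) - (h oo b)) $ n - (a - b) $ n
      = (\<Sum>i=0..n. e $ i * ((a ^ i) $ n - (b ^ i) $ n))" for n
    by (simp only: fps_compose_nth right_diff_distrib sum_subtractf)
  have z: "e $ i * ((a ^ i) $ n - (b ^ i) $ n) = 0"
    if "n \<le> p + k" "i \<noteq> Suc k \<or> n < p + k" for i n
  proof (cases "i < Suc k")
    case True then show ?thesis using e by (simp add: agree_def)
  next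
    case False
    then have "n < p + i - 1" using that by auto
    then have "(a ^ i) $ n = (b ^ i) $ n" using P[of i] unfolding agree_def by auto
    then show ?thesis by simp
  qed
  have "((h oo a) - (h oo b)) $ n - (a - b) $ n = 0" if "n < p + k" for n
    unfolding eq by (rule sum.neutral) (use z that in auto)
  then show "agree (p + k) ((h oo a) - (h oo b)) (a - b)" by (simp add: agree_def)
  have "((h oo a) - (h oo b)) $ (p + k) - (a - b) $ (p + k)
      = (\<Sum>i\<in>{Suc k}. e $ i * ((a ^ i) $ (p + k) - (b ^ i) $ (p + k)))"
    unfolding eq by (rule sum.mono_neutral_right) (use z p in auto)
  also have "\<dots> = h $ Suc k * (of_nat (Suc k) * (a $ p - b $ p))"
    using P[of "Suc k"] ek by simp
  also have "\<dots> = of_nat (Suc k) * (h $ Suc k * (a $ p - b $ p))"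
    by (metis mult.assoc mult_of_nat_commute)
  finally show "((h oo a) - (h oo b)) $ (p + k)
      = (a - b) $ (p + k) + of_nat (Suc k) * (h $ Suc k * (a $ p - b $ p))"
    by (simp add: algebra_simps)
qed

text \<open>
  A left translation of \<open>J\<close> carries the first discrepancy between two series over unchanged. So
  does a right translation, and hence both kinds are injective, even modulo any power of \<open>t\<close>.
\<close>

lemma agree_compose_inner:
  fixes u v w :: "'a::ring_1 fps"
  assumes w: "w \<in> J_sub 1" and u: "u \<in> J_sub 1" and v: "v \<in> J_sub 1" and q: "agree q u v"
  shows "agree q (w oo u) (w oo v)" and "(w oo u) $ q - (w oo v) $ q = u $ q - v $ q"
proof -
  have "agree q (w oo u) (w oo v) \<and> (w oo u) $ q - (w oo v) $ q = u $ q - v $ q"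
  proof (cases "q = 0")
    case True then show ?thesis using u v by (simp add: agree_def J_sub_1_iff)
  next
    case False
    then have "agree (q + 1) ((w oo u) - (w oo v)) (u - v)"
      using compose_outer_lead(1)[OF w _ u v q] by simp
    then have "agree q ((w oo u) - (w oo v)) (u - v)" "((w oo u) - (w oo v)) $ q = (u - v) $ q"
      by (simp_all add: agree_Suc)
    then show ?thesis using q by (simp add: agree_def)
  qed
  then show "agree q (w oo u) (w oo v)" and "(w oo u) $ q - (w oo v) $ q = u $ q - v $ q"
    by auto
qed

lemma agree_compose_outer:
  fixes u v w :: "'a::ring_1 fps"
  assumes w: "w \<in> J_sub 1" and q: "agree q u v"
  shows "agree q (u oo w) (v oo w)" and "(u oo w) $ q - (v oo w) $ q = u $ q - v $ q"
proof -
  have "agree q (u - v) 0" using q by (simp add: agree_diff)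
  from compose_inner_lead(1)[OF this w]
  have "agree (Suc q) ((u oo w) - (v oo w)) (u - v)" by (simp add: compose_diff_left)
  then have "agree q ((u oo w) - (v oo w)) (u - v)" "((u oo w) - (v oo w)) $ q = (u - v) $ q"
    by (simp_all add: agree_Suc)
  then show "agree q (u oo w) (v oo w)" "(u oo w) $ q - (v oo w) $ q = u $ q - v $ q"
    using q by (simp_all add: agree_def)
qed

lemma agree_compose_inner_iff:
  fixes u v w :: "'a::ring_1 fps"
  assumes "w \<in> J_sub 1" "u \<in> J_sub 1" "v \<in> J_sub 1"
  shows "agree q (w oo u) (w oo v) \<longleftrightarrow> agree q u v"
proof
  show "agree q (w oo u) (w oo v) \<Longrightarrow> agree q u v"
  proof (induction q)
    case (Suc q)
    then have "agree q u v" by (simp add: agree_Suc)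
    from agree_compose_inner(2)[OF assms this] Suc show ?case by (simp add: agree_Suc)
  qed (simp add: agree_def)
qed (rule agree_compose_inner(1)[OF assms])

lemma agree_compose_outer_iff:
  fixes u v w :: "'a::ring_1 fps"
  assumes "w \<in> J_sub 1"
  shows "agree q (u oo w) (v oo w) \<longleftrightarrow> agree q u v"
proof
  show "agree q (u oo w) (v oo w) \<Longrightarrow> agree q u v"
  proof (induction q)
    case (Suc q)
    then have "agree q u v" by (simp add: agree_Suc)
    from agree_compose_outer(2)[OF assms this] Suc show ?case by (simp add: agree_Suc)
  qed (simp add: agree_def)
qed (rule agree_compose_outer(1)[OF assms])

lemma compose_nth_2:
  fixes x y :: "'a::ring_1 fps"
  assumes x: "x \<in> J_sub 1" and y: "y \<in> J_sub 1"
  shows "(x oo y) $ 2 = x $ 2 + y $ 2"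
proof -
  have "agree 2 y fps_X" using y by (simp only: J_1_iff_agree)
  from agree_compose_inner(2)[OF x y fps_X_in_J this] show ?thesis
    by (simp add: fps_compose_X algebra_simps)
qed

lemma compose_inner_second_order:
  fixes z h :: "'a::ring_1 fps"
  assumes z: "z \<in> J_sub 1" and h: "h \<in> J_sub n" "1 \<le> n"
  shows "agree (Suc n) (z oo h) z" and "(z oo h) $ Suc n = z $ Suc n + h $ Suc n"
    and "(z oo h) $ Suc (Suc n) = z $ Suc (Suc n) + h $ Suc (Suc n) + of_nat 2 * (z $ 2 * h $ Suc n)"
proof -
  have h1: "h \<in> J_sub 1" using h J_sub_subset_1 by auto
  have hX: "agree (Suc n) h fps_X" using h by (simp add: J_sub_iff_agree)
  note A = agree_compose_inner[OF z h1 fps_X_in_J hX, unfolded fps_compose_X]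
  show "agree (Suc n) (z oo h) z" by (rule A(1))
  show "(z oo h) $ Suc n = z $ Suc n + h $ Suc n" using A(2) h(2) by (simp add: algebra_simps)
  have "(z oo h) $ Suc (Suc n) - z $ Suc (Suc n) = h $ Suc (Suc n) + of_nat 2 * (z $ 2 * h $ Suc n)"
    using compose_outer_lead(2)[OF z _ h1 fps_X_in_J hX] h(2) by (simp add: fps_compose_X numeral_2_eq_2)
  then show "(z oo h) $ Suc (Suc n) = z $ Suc (Suc n) + h $ Suc (Suc n) + of_nat 2 * (z $ 2 * h $ Suc n)"
    by (simp add: algebra_simps)
qed

section \<open>The loop of substitutions\<close>

text \<open>
  An equation \<open>D a = 0\<close> in power series can be solved one coefficient at a time if the coefficient
  of \<open>a\<close> in degree \<open>p\<close> first shows in degree \<open>p + k\<close> of \<open>D a\<close>, and does so linearly with an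
  invertible factor. Division in \<open>J\<close> is the case \<open>k = 0\<close>; the shift \<open>k > 0\<close> occurs when a
  prescribed series is to be written as a commutator.
\<close>

lemma successive_approximation:
  fixes D :: "'a::ring_1 fps \<Rightarrow> 'a fps"
  assumes start: "agree (p0 + k) (D a0) 0"
    and step: "\<And>p a b. \<lbrakk>p0 \<le> p; agree p0 a a0; agree p0 b a0; agree p a b\<rbrakk> \<Longrightarrow>
      agree (p + k) (D a) (D b) \<and> D a $ (p + k) - D b $ (p + k) = c p * (a $ p - b $ p)"
    and surj: "\<And>p y. p0 \<le> p \<Longrightarrow> \<exists>x. c p * x = y"
  shows "\<exists>a. agree p0 a a0 \<and> D a = 0"
proof -
  define r where "r p y = (SOME x. c p * x = y)" for p y
  have r: "c p * r p y = y" if "p0 \<le> p" for p y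
    unfolding r_def by (rule someI_ex) (rule surj[OF that])
  define F where "F = rec_nat a0 (\<lambda>i f. f - fps_const (r (p0 + i) (D f $ (p0 + i + k))) * fps_X ^ (p0 + i))"
  have F0: "F 0 = a0" by (simp add: F_def)
  have FS: "F (Suc i) = F i - fps_const (r (p0 + i) (D (F i) $ (p0 + i + k))) * fps_X ^ (p0 + i)" for i
    by (simp add: F_def)
  have near: "agree (p0 + i) (F (Suc i)) (F i)" for i
    by (simp add: FS agree_def)
  have Cauchy: "agree (p0 + i) (F (i + m)) (F i)" for i m
  proof (induction m)
    case (Suc m)
    have "agree (p0 + i) (F (i + Suc m)) (F (i + m))"
      using near[of "i + m"] by (auto intro: agree_mono)
    then show ?case using Suc agree_trans by blast
  qed simp
  have F_a0: "agree p0 (F i) a0" for i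
    using Cauchy[of 0 i] by (simp add: F0)
  \<comment> \<open>The \<open>i\<close>-th correction removes the error in degree \<open>p0 + i + k\<close> without creating a lower one.\<close>
  have zero: "agree (p0 + i + k) (D (F i)) 0" for i
  proof (induction i)
    case 0 show ?case using start by (simp add: F0)
  next
    case (Suc i)
    have S: "agree (p0 + i + k) (D (F (Suc i))) (D (F i)) \<and>
        D (F (Suc i)) $ (p0 + i + k) - D (F i) $ (p0 + i + k)
          = c (p0 + i) * (F (Suc i) $ (p0 + i) - F i $ (p0 + i))"
      by (rule step) (auto simp: F_a0 near)
    have "F (Suc i) $ (p0 + i) - F i $ (p0 + i) = - r (p0 + i) (D (F i) $ (p0 + i + k))"
      by (simp add: FS)
    then have "D (F (Suc i)) $ (p0 + i + k) = 0"
      using S r[of "p0 + i"] by simp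
    moreover have "agree (p0 + i + k) (D (F (Suc i))) 0"
      using S Suc agree_trans by blast
    ultimately show ?case by (simp add: agree_Suc)
  qed
  define a where "a = Abs_fps (\<lambda>j. F (Suc j) $ j)"
  have a_F: "agree (p0 + i) a (F i)" for i
    unfolding agree_def
  proof (intro allI impI)
    fix j assume j: "j < p0 + i"
    show "a $ j = F i $ j"
    proof (cases "Suc j \<le> i")
      case True
      then have "F i $ j = F (Suc j) $ j"
        using Cauchy[of "Suc j" "i - Suc j"] by (auto simp: agree_def)
      then show ?thesis by (simp add: a_def)
    next
      case False
      then show ?thesis
        using Cauchy[of i "Suc j - i"] j by (auto simp: agree_def a_def)
    qed
  qed
  have "agree p0 a a0" using a_F[of 0] by (simp add: F0)
  moreover have "D a = 0"
  proof -
    have Z: "agree (p0 + i + k) (D a) 0" for i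
    proof -
      have "agree (p0 + i + k) (D a) (D (F i))"
        using step[of "p0 + i" a "F i"] \<open>agree p0 a a0\<close> F_a0 a_F by simp
      then show ?thesis using zero agree_trans by blast
    qed
    have "D a $ i = 0" for i
      using Z[of "Suc i"] by (simp add: agree_def)
    then show ?thesis by (simp add: fps_eq_iff)
  qed
  ultimately show ?thesis by blast
qed

lemma J_compose_closed:
  assumes "u \<in> J_sub 1" "v \<in> J_sub 1"
  shows "u oo v \<in> J_sub 1"
proof -
  have "agree 2 u fps_X" using assms(1) by (simp only: J_1_iff_agree)
  from agree_compose_outer(1)[OF assms(2) this] have "agree 2 (u oo v) v"
    using assms(2) by (simp add: fps_X_compose J_sub_1_iff)
  then show ?thesis using assms(2) agree_trans unfolding J_1_iff_agree by blast
qed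

lemma J_ex_ldiv:
  fixes u v :: "'a::ring_1 fps"
  assumes u: "u \<in> J_sub 1" and v: "v \<in> J_sub 1"
  shows "\<exists>z\<in>J_sub 1. u oo z = v"
proof -
  have "\<exists>z. agree 2 z fps_X \<and> (u oo z) - v = 0"
  proof (rule successive_approximation[where k = 0 and c = "\<lambda>_. 1"])
    show "agree (2 + 0) ((u oo fps_X) - v) 0"
    proof -
      have "agree 2 u v"
        using u v agree_trans agree_sym unfolding J_1_iff_agree by blast
      then show ?thesis by (simp add: agree_diff fps_compose_X)
    qed
    fix p :: nat and a b :: "'a fps"
    assume "agree 2 a fps_X" "agree 2 b fps_X" and ab: "agree p a b"
    then have "a \<in> J_sub 1" "b \<in> J_sub 1" by (simp_all only: J_1_iff_agree)
    from agree_compose_inner[OF u this ab]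
    show "agree (p + 0) ((u oo a) - v) ((u oo b) - v) \<and>
      ((u oo a) - v) $ (p + 0) - ((u oo b) - v) $ (p + 0) = 1 * (a $ p - b $ p)"
      by (simp add: agree_def)
  qed simp
  then show ?thesis unfolding Bex_def J_1_iff_agree by simp
qed

lemma J_ex_rdiv:
  fixes u v :: "'a::ring_1 fps"
  assumes u: "u \<in> J_sub 1" and v: "v \<in> J_sub 1"
  shows "\<exists>z\<in>J_sub 1. z oo u = v"
proof -
  have "\<exists>z. agree 2 z fps_X \<and> (z oo u) - v = 0"
  proof (rule successive_approximation[where k = 0 and c = "\<lambda>_. 1"])
    show "agree (2 + 0) ((fps_X oo u) - v) 0"
    proof -
      have "fps_X oo u = u" using u by (simp add: fps_X_compose J_sub_1_iff)
      moreover have "agree 2 u v"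
        using u v agree_trans agree_sym unfolding J_1_iff_agree by blast
      ultimately show ?thesis by (simp add: agree_diff)
    qed
    fix p :: nat and a b :: "'a fps"
    assume ab: "agree p a b"
    from agree_compose_outer[OF u ab]
    show "agree (p + 0) ((a oo u) - v) ((b oo u) - v) \<and>
      ((a oo u) - v) $ (p + 0) - ((b oo u) - v) $ (p + 0) = 1 * (a $ p - b $ p)"
      by (simp add: agree_def)
  qed simp
  then show ?thesis unfolding Bex_def J_1_iff_agree by simp
qed

lemma J_inner_cancel:
  assumes "w \<in> J_sub 1" "u \<in> J_sub 1" "v \<in> J_sub 1"
  shows "w oo u = w oo v \<longleftrightarrow> u = v"
  using agree_compose_inner_iff[OF assms] by (simp add: fps_eq_iff_agree)

lemma J_outer_cancel:
  assumes "w \<in> J_sub 1"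
  shows "u oo w = v oo w \<longleftrightarrow> u = v"
  using agree_compose_outer_iff[OF assms] by (simp add: fps_eq_iff_agree)

lemma J_loop_simps [simp]:
  "carrier J_loop = J_sub 1" "mult J_loop = (oo)" "one J_loop = fps_X"
  by (simp_all add: J_loop_def)

lemma loop_J_loop: "loop (J_loop :: 'a::ring_1 fps monoid)"
proof (unfold_locales, unfold J_loop_simps)
  fix x y :: "'a fps"
  assume x: "x \<in> J_sub 1" and y: "y \<in> J_sub 1"
  show "x oo y \<in> J_sub 1" using x y by (rule J_compose_closed)
  show "\<exists>!z. z \<in> J_sub 1 \<and> x oo z = y"
    using J_ex_ldiv[OF x y] J_inner_cancel[OF x] by blast
  show "\<exists>!z. z \<in> J_sub 1 \<and> z oo x = y"
  proof -
    obtain z where "z \<in> J_sub 1" "z oo x = y" using J_ex_rdiv[OF x y] by blast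
    then show ?thesis using J_outer_cancel[OF x] by (intro ex1I[of _ z]) auto
  qed
qed (auto simp: fps_X_compose fps_compose_X J_sub_1_iff)

lemma ldiv_J:
  fixes x y :: "'a::ring_1 fps"
  assumes "x \<in> J_sub 1" "y \<in> J_sub 1"
  shows "ldiv J_loop x y \<in> J_sub 1" "x oo ldiv J_loop x y = y"
  using theI'[OF loop.ex1_ldiv[OF loop_J_loop, of x y]] assms by (simp_all add: ldiv_def)

lemma rdiv_J:
  fixes x y :: "'a::ring_1 fps"
  assumes "x \<in> J_sub 1" "y \<in> J_sub 1"
  shows "rdiv J_loop y x \<in> J_sub 1" "rdiv J_loop y x oo x = y"
  using theI'[OF loop.ex1_rdiv[OF loop_J_loop, of x y]] assms by (simp_all add: rdiv_def)

text \<open>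
  As translations preserve the first discrepancy, \<open>x \ y\<close> deviates from the unit by the
  difference of \<open>y\<close> and \<open>x\<close> to leading order.
\<close>

lemma ldiv_agree:
  fixes x y :: "'a::ring_1 fps"
  assumes x: "x \<in> J_sub 1" and y: "y \<in> J_sub 1" and q: "agree q y x"
  shows "agree q (ldiv J_loop x y) fps_X"
    and "ldiv J_loop x y $ q = fps_X $ q + (y $ q - x $ q)"
proof -
  note z = ldiv_J[OF x y]
  show a: "agree q (ldiv J_loop x y) fps_X"
    using agree_compose_inner_iff[OF x z(1) fps_X_in_J, of q] q by (simp add: z fps_compose_X)
  show "ldiv J_loop x y $ q = fps_X $ q + (y $ q - x $ q)"
    using agree_compose_inner(2)[OF x z(1) fps_X_in_J a] unfolding z fps_compose_X
    by (simp add: algebra_simps)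
qed

lemma commutator_eqI:
  fixes a h g :: "'a::ring_1 fps"
  assumes "a \<in> J_sub 1" "h \<in> J_sub 1" "g \<in> J_sub 1" "(h oo a) oo g = a oo h"
  shows "commutator J_loop a h = g"
  unfolding commutator_def using assms
  by (intro loop.ldiv_eqI[OF loop_J_loop]) (auto simp: J_compose_closed[simplified])

section \<open>Commutators\<close>

text \<open>
  Both \<open>a \<circ> h\<close> and \<open>h \<circ> a\<close> are \<open>a + h - t\<close> up to a correction in degree \<open>m + k + 1\<close>,
  so the commutator is governed by the difference of the two corrections.
\<close>

lemma commutator_lead:
  fixes a h :: "'a::ring_1 fps"
  assumes a: "a \<in> J_sub m" "1 \<le> m" and h: "h \<in> J_sub k" "1 \<le> k"
  shows "commutator J_loop a h \<in> J_sub (m + k)"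
    and "commutator J_loop a h $ Suc (m + k)
      = of_nat (Suc m) * (a $ Suc m * h $ Suc k) - of_nat (Suc k) * (h $ Suc k * a $ Suc m)"
proof -
  have a1: "a \<in> J_sub 1" and h1: "h \<in> J_sub 1" using a h J_sub_subset_1 by auto
  have agX: "agree (Suc m) (a - fps_X) 0" "agree (Suc k) (h - fps_X) 0"
    using a h by (simp_all add: agree_diff J_sub_iff_agree)
  have dec: "a oo h = (a - fps_X oo h) + h" "h oo a = (h - fps_X oo a) + a"
    using a1 h1 by (simp_all add: compose_diff_left fps_X_compose J_sub_1_iff)
  note L = compose_inner_lead[OF agX(1) h] and R = compose_inner_lead[OF agX(2) a]
  have ag: "agree (Suc (m + k)) (a oo h) (h oo a)"
    unfolding agree_def
  proof (intro allI impI)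
    fix i assume i: "i < Suc (m + k)"
    have "(a - fps_X oo h) $ i = (a - fps_X) $ i" "(h - fps_X oo a) $ i = (h - fps_X) $ i"
      using L(1) R(1) i by (auto simp: agree_def)
    then show "(a oo h) $ i = (h oo a) $ i" unfolding dec fps_add_nth by simp
  qed
  have co: "(a oo h) $ Suc (m + k) - (h oo a) $ Suc (m + k)
     = of_nat (Suc m) * (a $ Suc m * h $ Suc k) - of_nat (Suc k) * (h $ Suc k * a $ Suc m)"
  proof -
    have "(a oo h) $ Suc (m + k) = (a - fps_X) $ Suc (m + k) + of_nat (Suc m) * (a $ Suc m * h $ Suc k) + h $ Suc (m + k)"
      unfolding dec(1) fps_add_nth using L(2) a(2) by simp
    moreover have "(h oo a) $ Suc (m + k) = (h - fps_X) $ Suc (m + k) + of_nat (Suc k) * (h $ Suc k * a $ Suc m) + a $ Suc (m + k)"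
      unfolding dec(2) fps_add_nth using R(2) h(2) by (simp add: add.commute)
    ultimately show ?thesis by simp
  qed
  note D = ldiv_agree[OF J_compose_closed[OF h1 a1] J_compose_closed[OF a1 h1] ag]
  show "commutator J_loop a h \<in> J_sub (m + k)"
    using D(1) a(2) by (simp add: commutator_def J_sub_iff_agree)
  show "commutator J_loop a h $ Suc (m + k)
      = of_nat (Suc m) * (a $ Suc m * h $ Suc k) - of_nat (Suc k) * (h $ Suc k * a $ Suc m)"
    using D(2) a(2) unfolding co by (simp add: commutator_def)
qed

text \<open>
  The equation \<open>a \<circ> h = (h \<circ> a) \<circ> g\<close> is solved by successive approximation. Perturbing \<open>a\<close>
  by \<open>\<delta>\<close> in degree \<open>p\<close> changes both sides equally up to degree \<open>p + k - 1\<close>; in degree \<open>p + k\<close>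
  the left side gains \<open>p \<delta>\<close> and the right side \<open>(k + 1) \<delta>\<close>. Starting in degree \<open>k + 2\<close>
  makes the factor \<open>p - (k + 1)\<close> positive, and \<open>g\<close> is so close to the unit that composing with
  it does not interfere.
\<close>

lemma commutator_surj:
  fixes h g :: "'a::ring_1 fps"
  assumes inv: "\<And>m. 0 < m \<Longrightarrow> \<exists>r::'a. of_nat m * r = 1"
    and h: "h \<in> J_sub k" "h $ Suc k = 1" "1 \<le> k" and g: "g \<in> J_sub (2 * k + 1)"
  shows "\<exists>a\<in>J_sub (Suc k). commutator J_loop a h = g"
proof -
  have h1: "h \<in> J_sub 1" and g1: "g \<in> J_sub 1" using h g J_sub_subset_1 by auto
  define D where "D a = (a oo h) - ((h oo a) oo g)" for a :: "'a fps"
  have "\<exists>a. agree (k + 2) a fps_X \<and> D a = 0"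
  proof (rule successive_approximation[where k = k and c = "\<lambda>p. of_nat (p - Suc k)"])
    have "agree (2 * k + 2) g fps_X" using g by (simp add: J_sub_iff_agree)
    from agree_compose_inner(1)[OF h1 g1 fps_X_in_J this]
    have "agree (2 * k + 2) (h oo g) h" by (simp add: fps_compose_X)
    then show "agree (k + 2 + k) (D fps_X) 0"
      using h1 by (simp add: D_def agree_diff fps_compose_X fps_X_compose J_sub_1_iff
          agree_sym mult_2 add.commute add.left_commute)
  next
    fix p and a b :: "'a fps"
    assume p: "k + 2 \<le> p" and aX: "agree (k + 2) a fps_X" and bX: "agree (k + 2) b fps_X"
      and ab: "agree p a b"
    have a1: "a \<in> J_sub 1" and b1: "b \<in> J_sub 1"
      using aX bX agree_mono[of "k + 2" _ _ 2] unfolding J_1_iff_agree by auto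
    have p1: "1 \<le> p" using p by simp
    have d: "agree p (a - b) 0" using ab by (simp add: agree_diff)
    define e where "e = (h oo a) - (h oo b)"
    note I = compose_inner_lead[OF d h(1,3)]
    note O = compose_outer_lead[OF h(1,3) a1 b1 ab p1]
    have "agree p e 0"
      using agree_compose_inner(1)[OF h1 a1 b1 ab] by (simp add: e_def agree_diff)
    from compose_inner_lead(1)[OF this g]
    \<comment> \<open>The series \<open>e\<close> has order at least \<open>p\<close>, so \<open>g\<close> alters it only from degree \<open>p + 2 * k + 1\<close> on.\<close>
    have eg: "agree (Suc (p + k)) (e oo g) e" by (auto intro: agree_mono)
    have DD: "D a - D b = ((a - b) oo h) - (e oo g)"
      by (simp add: D_def e_def compose_diff_left)
    have "agree (p + k) (D a - D b) 0"
      unfolding DD agree_diff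
      using I(1) eg O(1) unfolding e_def[symmetric] agree_Suc by (auto simp: agree_def)
    moreover have "(D a - D b) $ (p + k) = of_nat (p - Suc k) * (a $ p - b $ p)"
    proof -
      have "(D a - D b) $ (p + k) = ((a - b) oo h) $ (p + k) - e $ (p + k)"
        unfolding DD using eg by (simp add: agree_Suc)
      also have "\<dots> = of_nat p * (a $ p - b $ p) - of_nat (Suc k) * (a $ p - b $ p)"
        using I(2) O(2) h(2) unfolding e_def[symmetric] by simp
      also have "\<dots> = of_nat (p - Suc k) * (a $ p - b $ p)"
        using p by (simp add: of_nat_diff left_diff_distrib)
      finally show ?thesis .
    qed
    ultimately show "agree (p + k) (D a) (D b) \<and>
        D a $ (p + k) - D b $ (p + k) = of_nat (p - Suc k) * (a $ p - b $ p)"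
      by (simp add: agree_diff)
  next
    fix p and y :: 'a assume "k + 2 \<le> p"
    then obtain r :: 'a where "of_nat (p - Suc k) * r = 1" using inv[of "p - Suc k"] by auto
    then show "\<exists>x. of_nat (p - Suc k) * x = y" by (metis mult.assoc mult_1)
  qed
  then obtain a where a: "agree (k + 2) a fps_X" "D a = 0" by blast
  then have aJ: "a \<in> J_sub (Suc k)" by (simp add: J_sub_iff_agree)
  then have "a \<in> J_sub 1" using J_sub_subset_1 by auto
  then have "commutator J_loop a h = g"
    using a(2) h1 g1 by (intro commutator_eqI) (auto simp: D_def)
  then show ?thesis using aJ by blast
qed

section \<open>Associativity and commutation of substitutions to second order\<close>

text \<open>
  In degree \<open>n + 2\<close> both sides pick up the correction \<open>2 (x\<^sub>2 + y\<^sub>2) h\<^sub>n\<^sub>+\<^sub>1\<close>, where the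
  subscripts are degrees.
\<close>

lemma compose_assoc_second_order:
  fixes x y h :: "'a::ring_1 fps"
  assumes x: "x \<in> J_sub 1" and y: "y \<in> J_sub 1" and h: "h \<in> J_sub n" "1 \<le> n"
  shows "agree (n + 3) (x oo (y oo h)) ((x oo y) oo h)"
proof -
  have h1: "h \<in> J_sub 1" using h J_sub_subset_1 by auto
  note P = compose_inner_second_order[OF y h] and Q = compose_inner_second_order[OF J_compose_closed[OF x y] h]
  note yh = J_compose_closed[OF y h1]
  note A = agree_compose_inner[OF x yh y P(1)]
  have "(x oo (y oo h)) $ Suc (Suc n) = (x oo y) $ Suc (Suc n)
      + ((y oo h) $ Suc (Suc n) - y $ Suc (Suc n)) + of_nat 2 * (x $ 2 * h $ Suc n)"
    using compose_outer_lead(2)[OF x _ yh y P(1)] P(2) by (simp add: numeral_2_eq_2 algebra_simps)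
  also have "\<dots> = (x oo y oo h) $ Suc (Suc n)"
    using P(3) Q(3) by (simp add: compose_nth_2[OF x y] algebra_simps)
  finally have "agree (Suc (Suc (Suc n))) (x oo (y oo h)) ((x oo y) oo h)"
    using A P(2) Q(1,2) by (simp add: agree_Suc) (simp add: agree_def algebra_simps)
  then show ?thesis by (simp add: numeral_3_eq_3)
qed

text \<open>
  Moving \<open>h\<close> past \<open>y\<close> costs \<open>2 y\<^sub>2 h\<^sub>n\<^sub>+\<^sub>1 - (n + 1) h\<^sub>n\<^sub>+\<^sub>1 y\<^sub>2\<close> in degree \<open>n + 2\<close>, which is
  the leading coefficient of the commutator \<open>[y, h]\<close>; \<open>k\<close> is \<open>h\<close> with this amount removed.
\<close>

lemma compose_outer_second_order:
  fixes x y h k :: "'a::ring_1 fps"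
  assumes x: "x \<in> J_sub 1" and y: "y \<in> J_sub 1" and h: "h \<in> J_sub n" "1 \<le> n"
    and k: "k \<in> J_sub n" and hk: "agree (Suc (Suc n)) h k"
    and twist: "h $ Suc (Suc n) - k $ Suc (Suc n)
      = of_nat 2 * (y $ 2 * h $ Suc n) - of_nat (Suc n) * (h $ Suc n * y $ 2)"
  shows "agree (n + 3) ((x oo h) oo y) ((x oo y) oo k)"
proof -
  note P = compose_inner_second_order[OF x h] and Q = compose_inner_second_order[OF J_compose_closed[OF x y] k h(2)]
  note A = agree_compose_outer[OF y P(1)]
  have d: "agree (Suc n) ((x oo h) - x) 0" using P(1) by (simp add: agree_diff)
  have hkn: "h $ Suc n = k $ Suc n" using hk by (simp add: agree_def)
  have "((x oo h) oo y) $ Suc (Suc n) = (x oo y) $ Suc (Suc n)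
      + ((x oo h) $ Suc (Suc n) - x $ Suc (Suc n)) + of_nat (Suc n) * (h $ Suc n * y $ 2)"
    using compose_inner_lead(2)[OF d y] P(2)
    by (simp add: compose_diff_left numeral_2_eq_2 algebra_simps)
  also have "\<dots> = ((x oo y) oo k) $ Suc (Suc n)"
    using P(3) Q(3) twist by (simp add: compose_nth_2[OF x y] hkn algebra_simps)
  finally have "agree (Suc (Suc (Suc n))) ((x oo h) oo y) ((x oo y) oo k)"
    using A P(2) Q(1,2) hkn by (simp add: agree_Suc) (simp add: agree_def algebra_simps)
  then show ?thesis by (simp add: numeral_3_eq_3)
qed

section \<open>Normality in terms of cosets\<close>

text \<open>
  The two conditions say that left and right translations map cosets \<open>xH\<close> onto cosets. Then the
  cosets partition the loop, multiplication descends to them, and both divisions remain unique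
  since a translation that identifies two cosets would be non-injective on the loop itself.
\<close>

lemma normal_subloopI_cosets:
  assumes L: "loop L" and H: "subloop H L"
    and inner: "\<And>x y. x \<in> carrier L \<Longrightarrow> y \<in> carrier L \<Longrightarrow>
      (\<lambda>h. x \<otimes>\<^bsub>L\<^esub> (y \<otimes>\<^bsub>L\<^esub> h)) ` H = (\<lambda>h. (x \<otimes>\<^bsub>L\<^esub> y) \<otimes>\<^bsub>L\<^esub> h) ` H"
    and outer: "\<And>x y. x \<in> carrier L \<Longrightarrow> y \<in> carrier L \<Longrightarrow>
      (\<lambda>h. (x \<otimes>\<^bsub>L\<^esub> h) \<otimes>\<^bsub>L\<^esub> y) ` H = (\<lambda>h. (x \<otimes>\<^bsub>L\<^esub> y) \<otimes>\<^bsub>L\<^esub> h) ` H"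
  shows "normal_subloop H L"
proof -
  interpret loop L by fact
  define K where "K x = (\<lambda>h. x \<otimes>\<^bsub>L\<^esub> h) ` H" for x
  have HL: "h \<in> carrier L" if "h \<in> H" for h using H that by (auto simp: subloop_def)
  have one_H: "\<one>\<^bsub>L\<^esub> \<in> H" using H by (simp add: subloop_def)
  have K_sub: "K x \<subseteq> carrier L" if "x \<in> carrier L" for x
    using that HL m_closed by (auto simp: K_def)
  have K_self: "x \<in> K x" if "x \<in> carrier L" for x
    using r_one[OF that] one_H unfolding K_def by force
  have hH: "(\<lambda>k. h \<otimes>\<^bsub>L\<^esub> k) ` H = H" if "h \<in> H" for h
  proof
    show "(\<lambda>k. h \<otimes>\<^bsub>L\<^esub> k) ` H \<subseteq> H" using H that by (auto simp: subloop_def)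
    show "H \<subseteq> (\<lambda>k. h \<otimes>\<^bsub>L\<^esub> k) ` H"
    proof
      fix y assume y: "y \<in> H"
      have "h \<otimes>\<^bsub>L\<^esub> ldiv L h y = y"
        using theI'[OF ex1_ldiv[OF HL[OF that] HL[OF y]]] by (simp add: ldiv_def)
      moreover have "ldiv L h y \<in> H" using H that y by (simp add: subloop_def)
      ultimately show "y \<in> (\<lambda>k. h \<otimes>\<^bsub>L\<^esub> k) ` H" by force
    qed
  qed
  have K_inner: "(\<lambda>z. x \<otimes>\<^bsub>L\<^esub> z) ` K y = K (x \<otimes>\<^bsub>L\<^esub> y)" if "x \<in> carrier L" "y \<in> carrier L" for x y
    using inner[OF that] by (simp add: K_def image_image)
  have K_outer: "(\<lambda>z. z \<otimes>\<^bsub>L\<^esub> y) ` K x = K (x \<otimes>\<^bsub>L\<^esub> y)" if "x \<in> carrier L" "y \<in> carrier L" for x y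
    using outer[OF that] by (simp add: K_def image_image)
  have K_eq: "K x = K y" if x: "x \<in> carrier L" and y: "y \<in> K x" for x y
  proof -
    obtain h where h: "h \<in> H" "y = x \<otimes>\<^bsub>L\<^esub> h" using y by (auto simp: K_def)
    have "K y = (\<lambda>z. x \<otimes>\<^bsub>L\<^esub> z) ` K h" using K_inner[OF x HL[OF h(1)]] h(2) by simp
    also have "K h = H" using hH[OF h(1)] by (simp add: K_def)
    finally show ?thesis by (simp add: K_def)
  qed
  have K_iff: "K x = K y \<longleftrightarrow> y \<in> K x" if "x \<in> carrier L" "y \<in> carrier L" for x y
    using K_eq[OF that(1)] K_self[OF that(2)] by auto
  have cong: "K (x' \<otimes>\<^bsub>L\<^esub> y') = K (x \<otimes>\<^bsub>L\<^esub> y)"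
    if x: "x \<in> carrier L" "x' \<in> carrier L" "K x' = K x"
      and y: "y \<in> carrier L" "y' \<in> carrier L" "K y' = K y" for x x' y y'
  proof -
    have "K (x' \<otimes>\<^bsub>L\<^esub> y') = K (x' \<otimes>\<^bsub>L\<^esub> y)"
      using K_inner[OF x(2) y(2)] K_inner[OF x(2) y(1)] y(3) by simp
    also have "\<dots> = K (x \<otimes>\<^bsub>L\<^esub> y)"
      using K_outer[OF x(2) y(1)] K_outer[OF x(1) y(1)] x(3) by simp
    finally show ?thesis .
  qed
  have cancel_inner: "K b = K c"
    if a: "a \<in> carrier L" and b: "b \<in> carrier L" and c: "c \<in> carrier L"
      and eq: "K (a \<otimes>\<^bsub>L\<^esub> b) = K (a \<otimes>\<^bsub>L\<^esub> c)" for a b c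
  proof -
    have "a \<otimes>\<^bsub>L\<^esub> c \<in> (\<lambda>z. a \<otimes>\<^bsub>L\<^esub> z) ` K b"
      using K_self[OF m_closed[OF a c]] eq K_inner[OF a b] by simp
    then obtain z where z: "z \<in> K b" "a \<otimes>\<^bsub>L\<^esub> c = a \<otimes>\<^bsub>L\<^esub> z" by auto
    then have "z = c" using ex1_ldiv[OF a m_closed[OF a c]] K_sub[OF b] c by (metis subsetD)
    then show ?thesis using K_eq[OF b z(1)] by simp
  qed
  have cancel_outer: "K b = K c"
    if a: "a \<in> carrier L" and b: "b \<in> carrier L" and c: "c \<in> carrier L"
      and eq: "K (b \<otimes>\<^bsub>L\<^esub> a) = K (c \<otimes>\<^bsub>L\<^esub> a)" for a b c
  proof -
    have "c \<otimes>\<^bsub>L\<^esub> a \<in> (\<lambda>z. z \<otimes>\<^bsub>L\<^esub> a) ` K b"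
      using K_self[OF m_closed[OF c a]] eq K_outer[OF b a] by simp
    then obtain z where z: "z \<in> K b" "c \<otimes>\<^bsub>L\<^esub> a = z \<otimes>\<^bsub>L\<^esub> a" by auto
    then have "z = c" using ex1_rdiv[OF a m_closed[OF c a]] K_sub[OF b] c by (metis subsetD)
    then show ?thesis using K_eq[OF b z(1)] by simp
  qed
  \<comment> \<open>A representative of each coset; by \<open>cong\<close> the product on cosets does not depend on the choice.\<close>
  define r where "r A = (SOME x. x \<in> carrier L \<and> K x = A)" for A
  have r: "r (K x) \<in> carrier L \<and> K (r (K x)) = K x" if "x \<in> carrier L" for x
    unfolding r_def by (rule someI[of _ x]) (simp add: that)
  define Q :: "'a set monoid" where
    "Q = \<lparr>carrier = K ` carrier L, mult = (\<lambda>A B. K (r A \<otimes>\<^bsub>L\<^esub> r B)), one = K \<one>\<^bsub>L\<^esub>\<rparr>"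
  have Q_carrier: "carrier Q = K ` carrier L" and Q_one: "\<one>\<^bsub>Q\<^esub> = K \<one>\<^bsub>L\<^esub>"
    by (auto simp: Q_def)
  have Q_mult: "K x \<otimes>\<^bsub>Q\<^esub> K y = K (x \<otimes>\<^bsub>L\<^esub> y)" if "x \<in> carrier L" "y \<in> carrier L" for x y
    unfolding Q_def using cong[of x "r (K x)" y "r (K y)"] r that by simp
  have "loop Q"
  proof
    fix A B assume "A \<in> carrier Q" "B \<in> carrier Q"
    then obtain a b where a: "a \<in> carrier L" "A = K a" and b: "b \<in> carrier L" "B = K b"
      by (auto simp: Q_carrier)
    show "A \<otimes>\<^bsub>Q\<^esub> B \<in> carrier Q"
      using a b Q_mult m_closed by (auto simp: Q_carrier)
    show "\<exists>!C. C \<in> carrier Q \<and> A \<otimes>\<^bsub>Q\<^esub> C = B"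
    proof -
      obtain z where z: "z \<in> carrier L" "a \<otimes>\<^bsub>L\<^esub> z = b" using ex1_ldiv a b by blast
      show ?thesis
      proof (rule ex1I[of _ "K z"])
        show "K z \<in> carrier Q \<and> A \<otimes>\<^bsub>Q\<^esub> K z = B" using z a b Q_mult by (auto simp: Q_carrier)
        fix C assume C: "C \<in> carrier Q \<and> A \<otimes>\<^bsub>Q\<^esub> C = B"
        then obtain c where c: "c \<in> carrier L" "C = K c" by (auto simp: Q_carrier)
        then show "C = K z" using cancel_inner[OF a(1) c(1) z(1)] C a b z Q_mult by simp
      qed
    qed
    show "\<exists>!C. C \<in> carrier Q \<and> C \<otimes>\<^bsub>Q\<^esub> A = B"
    proof -
      obtain z where z: "z \<in> carrier L" "z \<otimes>\<^bsub>L\<^esub> a = b" using ex1_rdiv a b by blast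
      show ?thesis
      proof (rule ex1I[of _ "K z"])
        show "K z \<in> carrier Q \<and> K z \<otimes>\<^bsub>Q\<^esub> A = B" using z a b Q_mult by (auto simp: Q_carrier)
        fix C assume C: "C \<in> carrier Q \<and> C \<otimes>\<^bsub>Q\<^esub> A = B"
        then obtain c where c: "c \<in> carrier L" "C = K c" by (auto simp: Q_carrier)
        then show "C = K z" using cancel_outer[OF a(1) c(1) z(1)] C a b z Q_mult by simp
      qed
    qed
  next
    fix A assume "A \<in> carrier Q"
    then obtain a where "a \<in> carrier L" "A = K a" by (auto simp: Q_carrier)
    then show "\<one>\<^bsub>Q\<^esub> \<otimes>\<^bsub>Q\<^esub> A = A" "A \<otimes>\<^bsub>Q\<^esub> \<one>\<^bsub>Q\<^esub> = A"
      using Q_mult one_closed l_one r_one by (auto simp: Q_one)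
  next
    show "\<one>\<^bsub>Q\<^esub> \<in> carrier Q" using one_closed by (auto simp: Q_one Q_carrier)
  qed
  moreover have "K \<in> hom L Q" using Q_mult by (auto simp: hom_def Q_carrier)
  moreover have "kernel L Q K = H"
  proof -
    have K1: "K \<one>\<^bsub>L\<^esub> = H" using hH[OF one_H] by (simp add: K_def)
    have "K x = H \<longleftrightarrow> x \<in> H" if "x \<in> carrier L" for x
      using K_iff[OF one_closed that] K1 by auto
    then show ?thesis unfolding kernel_def Q_one K1 using HL by auto
  qed
  ultimately show ?thesis
    using H unfolding normal_subloop_def by blast
qed

section \<open>Leading coefficients of a commutator-closed subloop\<close>

lemma mult_of_nat_left_commute: "x * (of_nat m * y) = of_nat m * (x * (y :: 'a::ring_1))"
  by (metis mult.assoc mult_of_nat_commute)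

definition leading_coeffs :: "'a::ring_1 fps set \<Rightarrow> nat \<Rightarrow> 'a set" where
  "leading_coeffs H k = (\<lambda>h. h $ Suc k) ` (H \<inter> J_sub k)"

locale commutator_closed_subloop =
  fixes H :: "'a::ring_1 fps set"
  assumes subloop_H: "subloop H J_loop"
    and commutator_H: "a \<in> J_sub 1 \<Longrightarrow> h \<in> H \<Longrightarrow> commutator J_loop a h \<in> H"
begin

lemma H_in_J: "h \<in> H \<Longrightarrow> h \<in> J_sub 1"
  using subloop_H by (auto simp: subloop_def)

lemma fps_X_in_H: "fps_X \<in> H"
  using subloop_H by (auto simp: subloop_def)

lemma compose_in_H: "x \<in> H \<Longrightarrow> y \<in> H \<Longrightarrow> x oo y \<in> H"
  using subloop_H by (auto simp: subloop_def)

lemma ldiv_in_H: "x \<in> H \<Longrightarrow> y \<in> H \<Longrightarrow> ldiv J_loop x y \<in> H"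
  using subloop_H by (auto simp: subloop_def)

lemma compose_in_H_cancel:
  assumes x: "x \<in> J_sub 1" and y: "y \<in> H" and xy: "x oo y \<in> H"
  shows "x \<in> H"
proof -
  have "rdiv J_loop (x oo y) y = x"
    using x xy H_in_J[OF y] H_in_J[OF xy]
    by (intro loop.rdiv_eqI[OF loop_J_loop]) (simp_all)
  then show ?thesis using subloop_H y xy by (metis subloop_def)
qed

lemma leading_coeffs_add:
  assumes k: "1 \<le> k" and "x \<in> leading_coeffs H k" "y \<in> leading_coeffs H k"
  shows "x + y \<in> leading_coeffs H k"
proof -
  obtain f g where f: "f \<in> H" "f \<in> J_sub k" "x = f $ Suc k" and g: "g \<in> H" "g \<in> J_sub k" "y = g $ Suc k"
    using assms by (auto simp: leading_coeffs_def)
  have "agree (Suc k) g fps_X" using g k by (simp add: J_sub_iff_agree)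
  note C = agree_compose_inner[OF H_in_J[OF f(1)] H_in_J[OF g(1)] fps_X_in_J this, unfolded fps_compose_X]
  have "f oo g \<in> J_sub k"
    using C(1) f(2) k agree_trans by (metis J_sub_iff_agree)
  moreover have "(f oo g) $ Suc k = x + y" using C(2) f g k by (simp add: algebra_simps)
  ultimately show ?thesis using compose_in_H f g unfolding leading_coeffs_def by force
qed

lemma leading_coeffs_minus:
  assumes k: "1 \<le> k" and "x \<in> leading_coeffs H k"
  shows "- x \<in> leading_coeffs H k"
proof -
  obtain f where f: "f \<in> H" "f \<in> J_sub k" "x = f $ Suc k"
    using assms by (auto simp: leading_coeffs_def)
  have "agree (Suc k) fps_X f" using f k by (simp add: J_sub_iff_agree agree_sym)
  note C = ldiv_agree[OF H_in_J[OF f(1)] fps_X_in_J this]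
  have "ldiv J_loop f fps_X \<in> J_sub k" using C(1) k by (simp add: J_sub_iff_agree)
  moreover have "ldiv J_loop f fps_X $ Suc k = - x" using C(2) f k by simp
  ultimately show ?thesis using ldiv_in_H f fps_X_in_H unfolding leading_coeffs_def by force
qed

lemma leading_coeffs_diff:
  "\<lbrakk>1 \<le> k; x \<in> leading_coeffs H k; y \<in> leading_coeffs H k\<rbrakk> \<Longrightarrow> x - y \<in> leading_coeffs H k"
  using leading_coeffs_add[of k x "- y"] leading_coeffs_minus by simp

lemma leading_coeffs_of_nat_mult:
  assumes "1 \<le> k" "x \<in> leading_coeffs H k"
  shows "of_nat m * x \<in> leading_coeffs H k"
proof (induction m)
  case 0 show ?case using leading_coeffs_diff[OF assms(1,2,2)] by simp
next
  case (Suc m) then show ?case using leading_coeffs_add assms by (simp add: distrib_right)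
qed

lemma leading_coeffs_commutator:
  assumes k: "1 \<le> k" and m: "1 \<le> m" and "\<beta> \<in> leading_coeffs H k"
  shows "of_nat (Suc m) * (\<alpha> * \<beta>) - of_nat (Suc k) * (\<beta> * \<alpha>) \<in> leading_coeffs H (m + k)"
proof -
  obtain h where h: "h \<in> H" "h \<in> J_sub k" "\<beta> = h $ Suc k"
    using assms by (auto simp: leading_coeffs_def)
  define a where "a = fps_X + fps_const \<alpha> * fps_X ^ Suc m"
  have aJ: "a \<in> J_sub m" and am: "a $ Suc m = \<alpha>"
    using m by (auto simp: a_def J_sub_def simp del: power_Suc)
  have "a \<in> J_sub 1" using aJ J_sub_subset_1 by auto
  then have "commutator J_loop a h \<in> H" using commutator_H h(1) by simp
  with commutator_lead[OF aJ m h(2) k] show ?thesis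
    unfolding am h(3) leading_coeffs_def by (metis IntI imageI)
qed

text \<open>
  The groups of leading coefficients need not be closed under division by integers, but a family
  of elements that contains \<open>x a y\<close> for every \<open>a\<close> can absorb the denominator into \<open>a\<close>.
\<close>

lemma leading_coeffs_divide:
  assumes inv: "\<And>m. 0 < m \<Longrightarrow> \<exists>r::'a. of_nat m * r = 1"
    and m: "0 < m" and all: "\<And>a. of_nat m * (x * (a * y)) \<in> leading_coeffs H k"
  shows "x * (a * y) \<in> leading_coeffs H k"
proof -
  obtain r :: 'a where r: "of_nat m * r = 1" using inv[OF m] by blast
  have "of_nat m * (x * ((r * a) * y)) = x * (((of_nat m * r) * a) * y)"
    by (simp only: mult_of_nat_left_commute mult.assoc)
  then show ?thesis using all[of "r * a"] r by simp
qed

text \<open>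
  Put \<open>F a = 3 a\<beta> - (n+1) \<beta>a\<close> and \<open>\<gamma> a = 2 a\<beta> - (n+1) \<beta>a\<close>. Commutators with
  \<open>t + a t\<^sup>3\<close> put \<open>F a\<close> into degree \<open>n + 2\<close>, and two commutators with series \<open>t + b t\<^sup>2\<close> put
  \<open>2 b (\<gamma> a) - (n+2) (\<gamma> a) b\<close> there. For \<open>b = 1\<close> the latter is \<open>- n (\<gamma> a)\<close>, and
  \<open>n F a - n (\<gamma> a) = n a\<beta>\<close> gives \<open>R\<beta>\<close>; then \<open>F\<close> gives \<open>\<beta>R\<close>. For general \<open>b\<close> what
  remains is a combination of \<open>b\<beta>a\<close> and \<open>a\<beta>b\<close>; exchanging \<open>a\<close> and \<open>b\<close> yields a second such
  combination with the coefficients swapped, and the resulting system is nonsingular.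
\<close>

lemma leading_coeffs_two_sided:
  assumes inv: "\<And>m. 0 < m \<Longrightarrow> \<exists>r::'a. of_nat m * r = 1"
    and n: "1 \<le> n" and \<beta>: "\<beta> \<in> leading_coeffs H n"
  shows "\<alpha> * (\<beta> * \<alpha>') \<in> leading_coeffs H (n + 2)"
proof -
  let ?S = "leading_coeffs H (n + 2)"
  have le: "1 \<le> n + 2" by simp
  note diff = leading_coeffs_diff[OF le] and add = leading_coeffs_add[OF le]
    and smult = leading_coeffs_of_nat_mult[OF le]
  have F: "of_nat 3 * (a * \<beta>) - of_nat (Suc n) * (\<beta> * a) \<in> ?S" for a
    using leading_coeffs_commutator[OF n, of 2 \<beta> a] \<beta> by (simp add: add.commute numeral_3_eq_3)
  define \<gamma> where "\<gamma> a = of_nat 2 * (a * \<beta>) - of_nat (Suc n) * (\<beta> * a)" for a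
  have "\<gamma> a \<in> leading_coeffs H (Suc n)" for a
    using leading_coeffs_commutator[OF n, of 1 \<beta> a] \<beta> by (simp add: \<gamma>_def add.commute numeral_2_eq_2)
  then have E: "of_nat 2 * (b * \<gamma> a) - of_nat (n + 2) * (\<gamma> a * b) \<in> ?S" for a b
    using leading_coeffs_commutator[of "Suc n" 1 "\<gamma> a" b] by (simp add: numeral_2_eq_2)
  have left: "a * \<beta> \<in> ?S" for a
  proof -
    have "of_nat n * (1 * (a * \<beta>)) \<in> ?S" for a
    proof -
      have "of_nat 2 * (1 * \<gamma> a) - of_nat (n + 2) * (\<gamma> a * 1) = - (of_nat n * \<gamma> a)"
        by (simp add: distrib_right mult_2)
      then have "- (of_nat n * \<gamma> a) \<in> ?S" using E[of 1 a] by simp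
      then have "of_nat n * (of_nat 3 * (a * \<beta>) - of_nat (Suc n) * (\<beta> * a)) + - (of_nat n * \<gamma> a) \<in> ?S"
        using smult[OF F] add by blast
      moreover have "of_nat 3 * (a * \<beta>) - of_nat (Suc n) * (\<beta> * a) - \<gamma> a = a * \<beta>"
        by (simp add: \<gamma>_def left_diff_distrib[symmetric])
      ultimately show ?thesis by (simp add: right_diff_distrib[symmetric])
    qed
    from leading_coeffs_divide[OF inv _ this] n show ?thesis by simp
  qed
  have right: "\<beta> * a \<in> ?S" for a
  proof -
    have "of_nat (Suc n) * (\<beta> * (a * 1)) \<in> ?S" for a
      using diff[OF smult[OF left, of 3 a] F[of a]] by simp
    from leading_coeffs_divide[OF inv _ this] show ?thesis by simp
  qed
  \<comment> \<open>The coefficients of \<open>b\<beta>a\<close> and \<open>a\<beta>b\<close> in the doubly iterated commutator, up to sign.\<close>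
  define p q where "p = 2 * Suc n" and "q = 2 * (n + 2)"
  have PQ: "of_nat p * (b * (\<beta> * a)) + of_nat q * (a * (\<beta> * b)) \<in> ?S" for a b
  proof -
    have "b * \<gamma> a = of_nat 2 * (b * (a * \<beta>)) - of_nat (Suc n) * (b * (\<beta> * a))"
      by (simp only: \<gamma>_def right_diff_distrib mult_of_nat_left_commute[of b])
    moreover have "\<gamma> a * b = of_nat 2 * (a * (\<beta> * b)) - of_nat (Suc n) * (\<beta> * (a * b))"
      by (simp only: \<gamma>_def left_diff_distrib mult.assoc)
    moreover have "of_nat 2 * (of_nat 2 * w - of_nat (Suc n) * x) - of_nat (n + 2) * (of_nat 2 * y - of_nat (Suc n) * z)
        = of_nat 4 * w + of_nat ((n + 2) * Suc n) * z - (of_nat p * x + of_nat q * y)" for w x y z :: 'a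
      unfolding p_def q_def
      by (simp only: right_diff_distrib mult.assoc[symmetric] of_nat_mult[symmetric])
        (simp add: mult.commute)
    ultimately have "of_nat 2 * (b * \<gamma> a) - of_nat (n + 2) * (\<gamma> a * b)
        = of_nat 4 * (b * a * \<beta>) + of_nat ((n + 2) * Suc n) * (\<beta> * (a * b))
          - (of_nat p * (b * (\<beta> * a)) + of_nat q * (a * (\<beta> * b)))"
      by (simp only: mult.assoc)
    then have "of_nat p * (b * (\<beta> * a)) + of_nat q * (a * (\<beta> * b))
        = of_nat 4 * (b * a * \<beta>) + of_nat ((n + 2) * Suc n) * (\<beta> * (a * b))
          - (of_nat 2 * (b * \<gamma> a) - of_nat (n + 2) * (\<gamma> a * b))"
      by simp
    then show ?thesis
      by (simp only:) (rule diff[OF add[OF smult[OF left] smult[OF right]] E])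
  qed
  have "of_nat (q * q - p * p) * (\<alpha> * ((\<beta> * \<alpha>') * 1)) \<in> ?S" for \<alpha> \<alpha>'
  proof -
    have le: "p * p \<le> q * q" by (intro mult_mono) (auto simp: p_def q_def)
    have "of_nat q * (of_nat p * x + of_nat q * y) - of_nat p * (of_nat p * y + of_nat q * x)
        = of_nat (q * q - p * p) * y" for x y :: 'a
      using le
      by (simp only: distrib_left mult.assoc[symmetric] of_nat_mult[symmetric] of_nat_diff left_diff_distrib)
        (simp add: mult.commute)
    from this[of "\<alpha>' * (\<beta> * \<alpha>)" "\<alpha> * (\<beta> * \<alpha>')"]
      diff[OF smult[OF PQ[of \<alpha>' \<alpha>], of q] smult[OF PQ[of \<alpha> \<alpha>'], of p]]
    show ?thesis by simp
  qed
  then have "of_nat (q * q - p * p) * (1 * (\<alpha> * (\<beta> * \<alpha>'))) \<in> ?S" for \<alpha> by simp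
  moreover have "0 < q * q - p * p" by (simp add: p_def q_def algebra_simps)
  ultimately show ?thesis using leading_coeffs_divide[OF inv, of "q * q - p * p" 1 "\<beta> * \<alpha>'"] by simp
qed

text \<open>
  The commutator of \<open>t + a t\<^sup>2\<close> with a series of leading coefficient \<open>1\<close> has leading coefficient
  \<open>(1 - k) a\<close>, which is why \<open>k = 1\<close> has to be excluded.
\<close>

lemma leading_coeffs_UNIV_Suc:
  assumes inv: "\<And>m. 0 < m \<Longrightarrow> \<exists>r::'a. of_nat m * r = 1"
    and k: "2 \<le> k" and U: "leading_coeffs H k = UNIV"
  shows "leading_coeffs H (Suc k) = UNIV"
proof -
  obtain j where j: "k = Suc j" "0 < j" using k by (cases k) auto
  have "of_nat j * (1 * (a * 1)) \<in> leading_coeffs H (Suc k)" for a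
  proof -
    have "of_nat 2 * (a * 1) - of_nat (Suc k) * (1 * a) \<in> leading_coeffs H (Suc k)"
      using leading_coeffs_commutator[of k 1 1 a] k U by (simp add: numeral_2_eq_2)
    from leading_coeffs_minus[OF _ this]
    have "- (of_nat 2 * (a * 1) - of_nat (Suc k) * (1 * a)) \<in> leading_coeffs H (Suc k)"
      by simp
    then show ?thesis by (simp add: j(1) distrib_right mult_2)
  qed
  from leading_coeffs_divide[OF inv j(2) this] show ?thesis by auto
qed

text \<open>
  An element of \<open>J\<^sub>k\<close> has the leading coefficient of some \<open>h \<in> H \<inter> J\<^sub>k\<close>, and dividing by \<open>h\<close>
  moves it into \<open>J\<^sub>k\<^sub>+\<^sub>1\<close>.
\<close>

lemma J_sub_descend:
  assumes k: "1 \<le> k" and U: "leading_coeffs H k = UNIV" and sub: "J_sub (Suc k) \<subseteq> H"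
  shows "J_sub k \<subseteq> H"
proof
  fix x :: "'a fps" assume x: "x \<in> J_sub k"
  then have x1: "x \<in> J_sub 1" using J_sub_subset_1 by auto
  have "x $ Suc k \<in> leading_coeffs H k" using U by simp
  then obtain h where h: "h \<in> H" "h \<in> J_sub k" "h $ Suc k = x $ Suc k"
    by (auto simp: leading_coeffs_def)
  have "agree (Suc k) x h"
    using x h(2) k agree_trans agree_sym by (metis J_sub_iff_agree)
  then have "agree (Suc (Suc k)) x h" using h(3) by (simp add: agree_Suc)
  from ldiv_agree(1)[OF H_in_J[OF h(1)] x1 this]
  have "ldiv J_loop h x \<in> J_sub (Suc k)" by (simp add: J_sub_iff_agree)
  then have "h oo ldiv J_loop h x \<in> H" using sub h(1) compose_in_H by auto
  then show "x \<in> H" using ldiv_J(2)[OF H_in_J[OF h(1)] x1] by simp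
qed

section \<open>Closedness and normality\<close>

lemma closed_H:
  assumes sub: "J_sub m \<subseteq> H" "1 \<le> m"
  shows "closedin J_topology H"
proof -
  have J: "J_open (J_sub 1 :: 'a fps set)"
    using J_compose_closed unfolding J_open_def by blast
  have "topspace J_topology \<subseteq> (J_sub 1 :: 'a fps set)"
    using openin_topspace[of J_topology] unfolding openin_J_topology J_open_def by blast
  moreover have "J_sub 1 \<subseteq> topspace (J_topology :: 'a fps topology)"
    using J unfolding openin_J_topology[symmetric] by (rule openin_subset)
  ultimately have top: "topspace J_topology = (J_sub 1 :: 'a fps set)" by blast
  have "J_open (J_sub 1 - H)"
    unfolding J_open_def
  proof (intro conjI ballI exI[of _ m])
    fix a assume a: "a \<in> J_sub 1 - H"
    show "(oo) a ` J_sub m \<subseteq> J_sub 1 - H"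
    proof
      fix y assume "y \<in> (oo) a ` J_sub m"
      then obtain b where b: "b \<in> J_sub m" "y = a oo b" by blast
      have "b \<in> H" using b sub by auto
      then have "y \<notin> H" using compose_in_H_cancel[of a b] a b by auto
      moreover have "y \<in> J_sub 1" using J_compose_closed[of a b] a b H_in_J[OF \<open>b \<in> H\<close>] by simp
      ultimately show "y \<in> J_sub 1 - H" by simp
    qed
  qed (use sub in auto)
  then show ?thesis using H_in_J by (auto simp: closedin_def top openin_J_topology)
qed

text \<open>
  Since \<open>J\<^sub>m \<subseteq> H\<close>, membership in \<open>H\<close> can be read off from the coefficients up to degree \<open>m\<close>.
\<close>

lemma agree_in_H:
  assumes sub: "J_sub m \<subseteq> H" "1 \<le> m" and u: "u \<in> H" and v: "v \<in> J_sub 1" and uv: "agree (Suc m) v u"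
  shows "v \<in> H"
proof -
  have "ldiv J_loop u v \<in> J_sub m"
    using ldiv_agree(1)[OF H_in_J[OF u] v uv] sub(2) by (simp add: J_sub_iff_agree)
  then have "u oo ldiv J_loop u v \<in> H" using sub(1) u compose_in_H by auto
  then show ?thesis using ldiv_J(2)[OF H_in_J[OF u] v] by simp
qed

text \<open>
  Solving for the other factor in \<open>x \<circ> (y \<circ> h) = (x \<circ> y) \<circ> h'\<close> and in
  \<open>(x \<circ> h) \<circ> y = (x \<circ> y) \<circ> h'\<close>, either of \<open>h\<close> and \<open>h'\<close> lies in \<open>H\<close> as soon as the other does:
  up to degree \<open>n + 2\<close> they are equal in the first case, and differ by a commutator from \<open>H\<close> in
  the second.
\<close>

lemma normal_H:
  assumes n: "1 \<le> n" and sub: "J_sub (n + 2) \<subseteq> H" and sup: "H \<subseteq> J_sub n"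
  shows "normal_subloop H J_loop"
proof (rule normal_subloopI_cosets[OF loop_J_loop subloop_H], unfold J_loop_simps)
  have sat: "v \<in> H" if "u \<in> H" "v \<in> J_sub 1" "agree (n + 3) v u" for u v
    using agree_in_H[OF sub _ that(1,2)] that(3) by (simp add: numeral_3_eq_3)
  fix x y :: "'a fps"
  assume x: "x \<in> J_sub 1" and y: "y \<in> J_sub 1"
  note xy = J_compose_closed[OF x y]
  show "(\<lambda>h. x oo (y oo h)) ` H = (\<lambda>h. (x oo y) oo h) ` H"
  proof (intro equalityI image_subsetI)
    fix h assume h: "h \<in> H"
    have w: "x oo (y oo h) \<in> J_sub 1" using J_compose_closed x y H_in_J[OF h] by blast
    define h' where "h' = ldiv J_loop (x oo y) (x oo (y oo h))"
    have h': "h' \<in> J_sub 1" "(x oo y) oo h' = x oo (y oo h)"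
      unfolding h'_def using ldiv_J[OF xy w] by auto
    have "agree (n + 3) ((x oo y) oo h') ((x oo y) oo h)"
      using compose_assoc_second_order[OF x y _ n, of h] h sup by (auto simp: h')
    then have "agree (n + 3) h' h"
      using agree_compose_inner_iff[OF xy h'(1) H_in_J[OF h]] by simp
    then have "h' \<in> H" using sat h h' by blast
    then show "x oo (y oo h) \<in> (\<lambda>h. (x oo y) oo h) ` H" using h'(2) by (metis imageI)
  next
    fix h' assume h': "h' \<in> H"
    have w: "(x oo y) oo h' \<in> J_sub 1" using J_compose_closed xy H_in_J[OF h'] by blast
    define u where "u = ldiv J_loop x ((x oo y) oo h')"
    have u: "u \<in> J_sub 1" "x oo u = (x oo y) oo h'" unfolding u_def using ldiv_J[OF x w] by auto
    define h where "h = ldiv J_loop y u"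
    have h: "h \<in> J_sub 1" "y oo h = u" unfolding h_def using ldiv_J[OF y u(1)] by auto
    have yh': "y oo h' \<in> J_sub 1" using J_compose_closed y H_in_J[OF h'] by blast
    have "agree (n + 3) (x oo u) (x oo (y oo h'))"
      using compose_assoc_second_order[OF x y _ n, of h'] h' sup by (auto simp: u agree_sym)
    then have "agree (n + 3) (y oo h) (y oo h')"
      using agree_compose_inner_iff[OF x u(1) yh'] by (simp add: h)
    then have "agree (n + 3) h h'"
      using agree_compose_inner_iff[OF y h(1) H_in_J[OF h']] by simp
    then have "h \<in> H" using sat h' h by blast
    then show "(x oo y) oo h' \<in> (\<lambda>h. x oo (y oo h)) ` H" using h(2) u(2) by (metis imageI)
  qed
  \<comment> \<open>The commutator \<open>[y, h]\<close> is the twist that moving \<open>h\<close> past \<open>y\<close> requires.\<close>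
  have twist: "\<exists>c\<in>H. agree (Suc (Suc n)) c fps_X \<and> c $ Suc (Suc n)
      = of_nat 2 * (y $ 2 * h $ Suc n) - of_nat (Suc n) * (h $ Suc n * y $ 2)" if h: "h \<in> H" for h
  proof -
    have hn: "h \<in> J_sub n" using h sup by blast
    have "commutator J_loop y h \<in> H" using commutator_H y h by simp
    moreover have "agree (Suc (Suc n)) (commutator J_loop y h) fps_X"
      using commutator_lead(1)[OF y _ hn n] by (simp add: J_sub_iff_agree)
    ultimately show ?thesis
      using commutator_lead(2)[OF y _ hn n] by (auto simp: numeral_2_eq_2)
  qed
  show "(\<lambda>h. (x oo h) oo y) ` H = (\<lambda>h. (x oo y) oo h) ` H"
  proof (intro equalityI image_subsetI)
    fix h assume h: "h \<in> H"
    obtain c where c: "c \<in> H" "agree (Suc (Suc n)) c fps_X"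
      "c $ Suc (Suc n) = of_nat 2 * (y $ 2 * h $ Suc n) - of_nat (Suc n) * (h $ Suc n * y $ 2)"
      using twist[OF h] by blast
    \<comment> \<open>Dividing by \<open>c\<close> removes the twist from \<open>h\<close>; multiplying by \<open>c\<close> below inserts it.\<close>
    define k where "k = rdiv J_loop h c"
    have k: "k \<in> H" "k oo c = h"
      using rdiv_J[OF H_in_J[OF c(1)] H_in_J[OF h]] h c(1) subloop_H by (auto simp: k_def subloop_def)
    note A = agree_compose_inner[OF H_in_J[OF k(1)] H_in_J[OF c(1)] fps_X_in_J c(2),
        unfolded fps_compose_X k(2)]
    have w: "(x oo h) oo y \<in> J_sub 1" using J_compose_closed x y H_in_J[OF h] by blast
    define h' where "h' = ldiv J_loop (x oo y) ((x oo h) oo y)"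
    have h': "h' \<in> J_sub 1" "(x oo y) oo h' = (x oo h) oo y"
      unfolding h'_def using ldiv_J[OF xy w] by auto
    have "agree (n + 3) ((x oo h) oo y) ((x oo y) oo k)"
      by (rule compose_outer_second_order[OF x y _ n]) (use h k sup A c(3) in auto)
    then have "agree (n + 3) h' k"
      using agree_compose_inner_iff[OF xy h'(1) H_in_J[OF k(1)]] by (simp add: h')
    then have "h' \<in> H" using sat k h' by blast
    then show "(x oo h) oo y \<in> (\<lambda>h. (x oo y) oo h) ` H" using h'(2) by (metis imageI)
  next
    fix h' assume h': "h' \<in> H"
    obtain c where c: "c \<in> H" "agree (Suc (Suc n)) c fps_X"
      "c $ Suc (Suc n) = of_nat 2 * (y $ 2 * h' $ Suc n) - of_nat (Suc n) * (h' $ Suc n * y $ 2)"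
      using twist[OF h'] by blast
    define k where "k = h' oo c"
    have k: "k \<in> H" using compose_in_H h' c(1) by (simp add: k_def)
    note A = agree_compose_inner[OF H_in_J[OF h'] H_in_J[OF c(1)] fps_X_in_J c(2),
        unfolded fps_compose_X k_def[symmetric]]
    have kS: "k $ Suc n = h' $ Suc n" using A(1) by (simp add: agree_def)
    have w: "(x oo y) oo h' \<in> J_sub 1" using J_compose_closed xy H_in_J[OF h'] by blast
    define u where "u = rdiv J_loop ((x oo y) oo h') y"
    have u: "u \<in> J_sub 1" "u oo y = (x oo y) oo h'" unfolding u_def using rdiv_J[OF y w] by auto
    define h where "h = ldiv J_loop x u"
    have h: "h \<in> J_sub 1" "x oo h = u" unfolding h_def using ldiv_J[OF x u(1)] by auto
    have "agree (n + 3) ((x oo k) oo y) ((x oo y) oo h')"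
      by (rule compose_outer_second_order[OF x y _ n]) (use h' k sup A c(3) kS in auto)
    then have "agree (n + 3) ((x oo h) oo y) ((x oo k) oo y)" by (simp add: h u agree_sym)
    then have "agree (n + 3) (x oo h) (x oo k)" using agree_compose_outer_iff[OF y] by blast
    then have "agree (n + 3) h k"
      using agree_compose_inner_iff[OF x h(1) H_in_J[OF k]] by simp
    then have "h \<in> H" using sat k h by blast
    then show "(x oo y) oo h' \<in> (\<lambda>h. (x oo h) oo y) ` H" using h(2) u(2) by (metis imageI)
  qed
qed

end

section \<open>Simple algebras in characteristic zero\<close>

lemma of_nat_right_inverse:
  fixes scale :: "'k::field_char_0 \<Rightarrow> 'a::ring_1 \<Rightarrow> 'a"
  assumes "unital_algebra scale" and m: "0 < m"
  shows "\<exists>r::'a. of_nat m * r = 1"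
proof -
  interpret unital_algebra scale by fact
  have "scale (of_nat k) (1::'a) = of_nat k" for k
    by (induction k) (simp_all add: scale_left_distrib)
  then have "of_nat m * scale (1 / of_nat m) 1 = scale (of_nat m) 1 * scale (1 / of_nat m) (1::'a)"
    by simp
  also have "\<dots> = 1" using m by (simp add: scale_mult_left scale_mult_right)
  finally show ?thesis by blast
qed

text \<open>
  The elements \<open>x\<close> with \<open>a x b \<in> S\<close> for all \<open>a\<close> and \<open>b\<close> form a two-sided ideal; it contains
  \<open>\<beta>\<close>, so by simplicity it contains everything. Sandwiching turns the scalar factors into ring
  elements, so this set is a subspace although \<open>S\<close> is only closed under addition.
\<close>

lemma simple_algebra_sandwich:
  fixes scale :: "'k::field \<Rightarrow> 'a::ring_1 \<Rightarrow> 'a"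
  assumes "simple_unital_algebra scale"
    and zero: "(0::'a) \<in> S" and add: "\<And>x y. (x::'a) \<in> S \<Longrightarrow> y \<in> S \<Longrightarrow> x + y \<in> S"
    and \<beta>: "\<beta> \<noteq> (0::'a)" "\<And>a b. a * (\<beta> * b) \<in> S"
  shows "S = UNIV"
proof -
  interpret simple_unital_algebra scale by fact
  define I where "I = {x::'a. \<forall>a b. a * (x * b) \<in> S}"
  have "two_sided_ideal scale I"
    unfolding two_sided_ideal_def
  proof (intro conjI allI ballI)
    show "subspace I"
    proof (rule subspaceI)
      show "0 \<in> I" by (simp add: I_def zero)
      show "x + y \<in> I" if "x \<in> I" "y \<in> I" for x y
        using that add by (simp add: I_def distrib_left distrib_right)
      show "scale c x \<in> I" if "x \<in> I" for c x
      proof -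
        have "a * (scale c x * b) = scale c a * (x * b)" for a b
          by (simp add: scale_mult_left scale_mult_right)
        then show ?thesis using that by (simp add: I_def)
      qed
    qed
    fix r x assume x: "x \<in> I"
    have "a * ((r * x) * b) = (a * r) * (x * b)" "a * ((x * r) * b) = a * (x * (r * b))" for a b
      by (simp_all add: mult.assoc)
    then show "r * x \<in> I" "x * r \<in> I" using x by (simp_all add: I_def)
  qed
  moreover have "\<beta> \<in> I" using \<beta>(2) by (simp add: I_def)
  ultimately have "I = UNIV" using simple \<beta>(1) by blast
  then have "1 * (x * 1) \<in> S" for x unfolding I_def by blast
  then show ?thesis by auto
qed

section \<open>Commutator-closed subloops over a simple algebra\<close>

theorem proposition5p4:
  fixes scale :: "'k::field_char_0 \<Rightarrow> 'a::ring_1 \<Rightarrow> 'a"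
    and H :: "'a fps set"
  assumes "simple_unital_algebra scale"
    and "subloop H J_loop"
    and "H \<noteq> {fps_X}"
    and "\<forall>a\<in>carrier J_loop. \<forall>h\<in>H. commutator J_loop a h \<in> H"
  shows "(\<exists>n\<ge>1. J_sub (n + 2) \<subseteq> H \<and> H \<subseteq> J_sub n)
    \<and> closedin J_topology H \<and> normal_subloop H J_loop"
proof -
  interpret commutator_closed_subloop H
    using assms(2,4) by unfold_locales auto
  have inv: "\<exists>r::'a. of_nat m * r = 1" if "0 < m" for m
    using of_nat_right_inverse[OF simple_unital_algebra.axioms(1)[OF assms(1)] that] .
  \<comment> \<open>The lowest degree in which some element of \<open>H\<close> differs from the unit; it is \<open>n + 1\<close>.\<close>
  define q where "q = (LEAST q. \<exists>h\<in>H. h $ q \<noteq> fps_X $ q)"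
  have "\<exists>h\<in>H. h \<noteq> fps_X" using assms(3) fps_X_in_H by blast
  then have "\<exists>q. \<exists>h\<in>H. h $ q \<noteq> fps_X $ q" unfolding fps_eq_iff by blast
  then have "\<exists>h\<in>H. h $ q \<noteq> fps_X $ q" unfolding q_def by (rule LeastI_ex)
  then obtain h where h: "h \<in> H" "h $ q \<noteq> fps_X $ q" by blast
  have low: "agree q f fps_X" if "f \<in> H" for f
    unfolding agree_def q_def using that not_less_Least by blast
  have "agree 2 h fps_X" using H_in_J[OF h(1)] by (simp only: J_1_iff_agree)
  then have "\<not> q < 2" using h(2) unfolding agree_def by blast
  then obtain n where n: "q = Suc n" "1 \<le> n" by (cases q) auto
  have sup: "H \<subseteq> J_sub n" using low n by (auto simp: J_sub_iff_agree)
  define \<beta> where "\<beta> = h $ Suc n"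
  have \<beta>: "\<beta> \<noteq> 0" "\<beta> \<in> leading_coeffs H n"
    using h n sup by (auto simp: \<beta>_def leading_coeffs_def)
  have sandwich: "a * (\<beta> * b) \<in> leading_coeffs H (n + 2)" for a b
    using leading_coeffs_two_sided[OF inv n(2) \<beta>(2)] by blast
  have U0: "leading_coeffs H (n + 2) = UNIV"
  proof (rule simple_algebra_sandwich[OF assms(1)])
    show "0 \<in> leading_coeffs H (n + 2)" using sandwich[of 0 0] by simp
  qed (use leading_coeffs_add \<beta>(1) sandwich in auto)
  have U: "leading_coeffs H (n + 2 + i) = UNIV" for i
    by (induction i) (use U0 leading_coeffs_UNIV_Suc[OF inv] in auto)
  define k where "k = n + 2"
  have "1 \<in> leading_coeffs H k" using U0 by (simp add: k_def)
  then obtain g where g: "g \<in> H" "g \<in> J_sub k" "g $ Suc k = 1"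
    by (auto simp: leading_coeffs_def)
  have "J_sub (2 * k + 1) \<subseteq> H"
  proof
    fix f :: "'a fps" assume "f \<in> J_sub (2 * k + 1)"
    then obtain a where "a \<in> J_sub (Suc k)" "commutator J_loop a g = f"
      using commutator_surj[OF inv g(2,3)] by (auto simp: k_def)
    then show "f \<in> H" using commutator_H[of a g] g(1) J_sub_subset_1 by auto
  qed
  then have "J_sub (k + (k + 1)) \<subseteq> H" by (simp add: mult_2)
  moreover have "J_sub (k + i) \<subseteq> H \<Longrightarrow> J_sub k \<subseteq> H" for i
  proof (induction i)
    case (Suc i)
    then show ?case using J_sub_descend[of "k + i"] U[of i] by (simp add: k_def)
  qed simp
  ultimately have sub: "J_sub (n + 2) \<subseteq> H" unfolding k_def by blast
  then show ?thesis
    using n(2) sup closed_H[OF sub] normal_H[OF n(2) sub sup] by auto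
qed

end
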